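(* Let $\mathcal{H}$ be an infinite dimensional complex Hilbert space, let $r$ and $s$ be positive rational numbers such that $r+s>1$, and let $\phi:\mathcal{B}(\mathcal{H})\to\mathcal{B}(\mathcal{H})$ be a surjective function (not assumed linear or continuous) which satisfies $$\sigma\big(|A|^r B|A|^s\big)=\sigma\big(|\phi(A)|^r\phi(B)|\phi(A)|^s\big)$$ for all $A,B\in\mathcal{B}(\mathcal{H})$. Then there exists a bounded linear or conjugate linear bijection $T:\mathcal{H}\to\mathcal{H}$ satisfying $T^*=T^{-1}$ such that $$\phi(A)=TAT^*\quad\text{for all }A\in\mathcal{B}(\mathcal{H}).$$
   Context: $\mathcal{B}(\mathcal{H})$ is the space of all bounded linear operators on $\mathcal{H}$, $\sigma(A)$ is the spectrum of $A\in\mathcal{B}(\mathcal{H})$, and $|A|=(A^*A)^{1/2}$. For a positive rational number $r$, $|A|^r$ is defined by the continuous functional calculus. For a conjugate linear bounded $T$, the adjoint $T^*$ is the conjugate linear map determined by $\langle Tx,y\rangle=\langle T^*y,x\rangle$ for all $x,y$; thus the conclusion says that $T$ is unitary or antiunitary. *)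

theory Defs
  imports "HOL-Analysis.Analysis" "HOL-Computational_Algebra.Polynomial"
begin

section \<open>Complex Hilbert spaces\<close>

text \<open>The inner product is linear in the first and conjugate linear in the second argument.
  Positive definiteness follows from \<open>cinner_self\<close> and the norm axioms.\<close>

class complex_hilbert_space = real_normed_vector + complete_space +
  fixes scaleC :: "complex \<Rightarrow> 'a \<Rightarrow> 'a" (infixr "*\<^sub>C" 75)
    and cinner :: "'a \<Rightarrow> 'a \<Rightarrow> complex"
  assumes scaleC_add_right: "c *\<^sub>C (x + y) = c *\<^sub>C x + c *\<^sub>C y"
    and scaleC_add_left: "(c + d) *\<^sub>C x = c *\<^sub>C x + d *\<^sub>C x"
    and scaleC_scaleC: "c *\<^sub>C d *\<^sub>C x = (c * d) *\<^sub>C x"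
    and scaleC_of_real: "complex_of_real a *\<^sub>C x = a *\<^sub>R x"
    and cinner_commute: "cinner x y = cnj (cinner y x)"
    and cinner_add_left: "cinner (x + y) z = cinner x z + cinner y z"
    and cinner_scaleC_left: "cinner (c *\<^sub>C x) y = c * cinner x y"
    and cinner_self: "cinner x x = complex_of_real ((norm x)\<^sup>2)"
begin

subclass banach ..

end

lemma vector_space_scaleC:
  "vector_space (scaleC :: complex \<Rightarrow> 'h \<Rightarrow> 'h::complex_hilbert_space)"
proof
  show "1 *\<^sub>C x = x" for x :: 'h
    using scaleC_of_real[of 1 x] by simp
qed (simp_all add: scaleC_add_right scaleC_add_left scaleC_scaleC)


section \<open>Bounded operators\<close>

text \<open>The library type of bounded real linear maps contains both the complex linear and the
  conjugate linear bounded maps, with the operator norm; \<open>\<B>(\<H>)\<close> is the subset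
  \<open>bounded_ops\<close>.\<close>

definition bounded_ops :: "('h::complex_hilbert_space \<Rightarrow>\<^sub>L 'h) set" where
  "bounded_ops = {A. \<forall>c x. blinfun_apply A (c *\<^sub>C x) = c *\<^sub>C blinfun_apply A x}"

definition bounded_conj_ops :: "('h::complex_hilbert_space \<Rightarrow>\<^sub>L 'h) set" where
  "bounded_conj_ops = {A. \<forall>c x. blinfun_apply A (c *\<^sub>C x) = cnj c *\<^sub>C blinfun_apply A x}"

definition op_adjoint :: "('h::complex_hilbert_space \<Rightarrow>\<^sub>L 'h) \<Rightarrow> ('h \<Rightarrow>\<^sub>L 'h)" where
  "op_adjoint A =
     (THE B. \<forall>x y. cinner (blinfun_apply A x) y = cinner x (blinfun_apply B y))"

definition conj_op_adjoint :: "('h::complex_hilbert_space \<Rightarrow>\<^sub>L 'h) \<Rightarrow> ('h \<Rightarrow>\<^sub>L 'h)" where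
  "conj_op_adjoint A =
     (THE B. \<forall>x y. cinner (blinfun_apply A x) y = cinner (blinfun_apply B y) x)"

definition op_spectrum :: "('h::complex_hilbert_space \<Rightarrow>\<^sub>L 'h) \<Rightarrow> complex set" where
  "op_spectrum A = {c. \<not> (\<exists>B\<in>bounded_ops. \<forall>x.
     blinfun_apply B (blinfun_apply A x - c *\<^sub>C x) = x \<and>
     blinfun_apply A (blinfun_apply B x) - c *\<^sub>C blinfun_apply B x = x)}"


section \<open>Continuous functional calculus\<close>

definition op_poly :: "real poly \<Rightarrow> ('h::complex_hilbert_space \<Rightarrow>\<^sub>L 'h) \<Rightarrow> ('h \<Rightarrow>\<^sub>L 'h)" where
  "op_poly p A = (\<Sum>i\<le>degree p. coeff p i *\<^sub>R (((o\<^sub>L) A ^^ i) id_blinfun))"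

text \<open>Meant for self-adjoint \<open>A\<close> and real-valued \<open>f\<close> continuous on the (then real) spectrum of
  \<open>A\<close>: \<open>f(A)\<close> is the operator norm limit of \<open>p\<^sub>n(A)\<close> for every sequence of real polynomials \<open>p\<^sub>n\<close>
  converging to \<open>f\<close> uniformly on the spectrum. Such sequences exist by the Weierstrass theorem.\<close>

definition op_cfc :: "(real \<Rightarrow> real) \<Rightarrow> ('h::complex_hilbert_space \<Rightarrow>\<^sub>L 'h) \<Rightarrow> ('h \<Rightarrow>\<^sub>L 'h)" where
  "op_cfc f A = (THE B. \<forall>p :: nat \<Rightarrow> real poly.
     uniform_limit {t. complex_of_real t \<in> op_spectrum A} (\<lambda>n. poly (p n)) f sequentially \<longrightarrow>
     (\<lambda>n. op_poly (p n) A) \<longlonglongrightarrow> B)"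

definition op_abs :: "('h::complex_hilbert_space \<Rightarrow>\<^sub>L 'h) \<Rightarrow> ('h \<Rightarrow>\<^sub>L 'h)" where
  "op_abs A = op_cfc sqrt (op_adjoint A o\<^sub>L A)"

text \<open>For exponents \<open>r > 0\<close>; note that \<open>0 powr r = 0\<close>.\<close>

definition op_abs_powr :: "('h::complex_hilbert_space \<Rightarrow>\<^sub>L 'h) \<Rightarrow> real \<Rightarrow> ('h \<Rightarrow>\<^sub>L 'h)" where
  "op_abs_powr A r = op_cfc (\<lambda>t. t powr r) (op_abs A)"

end

theory Submission
  imports Defs "HOL-Computational_Algebra.Fundamental_Theorem_Algebra"
begin

text \<open>Write \<open>x \<otimes> y\<close> for \<open>z \<mapsto> \<langle>z, y\<rangle> x\<close> and \<open>t = r + s\<close>. For \<open>A = x \<otimes> y\<close> the operator \<open>|A|\<^sup>r B |A|\<^sup>s\<close> has rank at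
  most one, and its spectrum consists of \<open>0\<close> and a positive multiple of \<open>\<langle>B y, y\<rangle>\<close>. The nonzero
  operators \<open>A\<close> of rank one are exactly those for which these spectra have at most one nonzero element
  for all \<open>B\<close>, and one for some \<open>B\<close>; hence \<open>\<phi>\<close> preserves rank one in both directions, and to every
  \<open>w \<noteq> 0\<close> there is a \<open>v \<noteq> 0\<close> with \<open>\<langle>\<phi>(B) w, w\<rangle> = \<langle>B v, v\<rangle>\<close> for all \<open>B\<close>, and conversely. So \<open>\<phi>\<close> is complex
  linear. For a fixed unit vector \<open>e\<close> it follows that \<open>\<phi>(x \<otimes> e) = T x \<otimes> f\<close> with \<open>T\<close> linear; comparing
  spectra shows that \<open>T\<close> is unitary and \<open>f = T e\<close>. Inserting \<open>B = x \<otimes> e\<close> into the identity of forms gives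
  \<open>w = \<lambda> T v\<close> with \<open>|\<lambda>| = 1\<close> whenever \<open>\<langle>v, e\<rangle> \<noteq> 0\<close>, so \<open>T\<^sup>* \<phi>(B) T\<close> and \<open>B\<close> have the same quadratic form. The conjugate linear
  alternative never occurs.\<close>

section \<open>Inner products\<close>

interpretation scaleC: vector_space "scaleC :: complex \<Rightarrow> 'h \<Rightarrow> 'h::complex_hilbert_space"
  by (rule vector_space_scaleC)

lemma scaleR_eq_scaleC: "a *\<^sub>R x = complex_of_real a *\<^sub>C (x :: 'h::complex_hilbert_space)"
  by (simp add: scaleC_of_real)

lemma cinner_add_right: "cinner x (y + z) = cinner x y + cinner x (z :: 'h::complex_hilbert_space)"
  by (metis cinner_add_left cinner_commute complex_cnj_add)

lemma cinner_scaleC_right: "cinner x (c *\<^sub>C y) = cnj c * cinner x (y :: 'h::complex_hilbert_space)"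
  by (metis cinner_commute cinner_scaleC_left complex_cnj_mult)

lemma cinner_scaleR_left: "cinner (a *\<^sub>R x) y = of_real a * cinner x (y :: 'h::complex_hilbert_space)"
  by (simp add: scaleR_eq_scaleC cinner_scaleC_left)

lemma cinner_scaleR_right: "cinner x (a *\<^sub>R y) = of_real a * cinner x (y :: 'h::complex_hilbert_space)"
  by (simp add: scaleR_eq_scaleC cinner_scaleC_right)

lemma cinner_minus_left: "cinner (- x) y = - cinner x (y :: 'h::complex_hilbert_space)"
  using cinner_scaleR_left[of "-1" x y] by simp

lemma cinner_minus_right: "cinner x (- y) = - cinner x (y :: 'h::complex_hilbert_space)"
  using cinner_scaleR_right[of x "-1" y] by simp

lemma cinner_diff_left: "cinner (x - y) z = cinner x z - cinner y (z :: 'h::complex_hilbert_space)"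
  using cinner_add_left[of x "- y" z] by (simp add: cinner_minus_left)

lemma cinner_diff_right: "cinner x (y - z) = cinner x y - cinner x (z :: 'h::complex_hilbert_space)"
  using cinner_add_right[of x y "- z"] by (simp add: cinner_minus_right)

lemma cinner_zero_left [simp]: "cinner 0 (y :: 'h::complex_hilbert_space) = 0"
  using cinner_scaleR_left[of 0 0 y] by simp

lemma cinner_zero_right [simp]: "cinner (x :: 'h::complex_hilbert_space) 0 = 0"
  using cinner_scaleR_right[of x 0 0] by simp

lemmas cinner_simps = cinner_add_left cinner_add_right cinner_diff_left cinner_diff_right
  cinner_minus_left cinner_minus_right cinner_scaleC_left cinner_scaleC_right
  cinner_scaleR_left cinner_scaleR_right

lemma cinner_eq_zero_iff [simp]: "cinner x x = 0 \<longleftrightarrow> (x :: 'h::complex_hilbert_space) = 0"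
  by (simp add: cinner_self)

lemma power2_norm_eq_cinner: "(norm x)\<^sup>2 = Re (cinner x (x :: 'h::complex_hilbert_space))"
  by (simp add: cinner_self)

lemma Re_cinner_commute: "Re (cinner y x) = Re (cinner x (y :: 'h::complex_hilbert_space))"
  by (subst cinner_commute) simp

lemma cinner_mult_commute:
  "cinner x y * cinner y x = of_real ((cmod (cinner x (y :: 'h::complex_hilbert_space)))\<^sup>2)"
  by (subst (2) cinner_commute) (metis complex_norm_square)

lemma norm_scaleC [simp]: "norm (c *\<^sub>C x) = cmod c * norm (x :: 'h::complex_hilbert_space)"
proof -
  have "complex_of_real ((norm (c *\<^sub>C x))\<^sup>2) = c * cnj c * of_real ((norm x)\<^sup>2)"
    by (simp only: cinner_self[symmetric] cinner_simps mult_ac)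
  also have "\<dots> = of_real ((cmod c * norm x)\<^sup>2)"
    by (simp add: complex_norm_square[symmetric] power_mult_distrib)
  finally have "(norm (c *\<^sub>C x))\<^sup>2 = (cmod c * norm x)\<^sup>2"
    using of_real_eq_iff by blast
  then show ?thesis by (simp add: power2_eq_iff_nonneg)
qed

lemma norm_diff_power2:
  "(norm (x - y))\<^sup>2 = (norm x)\<^sup>2 + (norm y)\<^sup>2 - 2 * Re (cinner x (y :: 'h::complex_hilbert_space))"
  by (simp add: power2_norm_eq_cinner cinner_simps Re_cinner_commute)

lemma norm_add_power2:
  "(norm (x + y))\<^sup>2 = (norm x)\<^sup>2 + (norm y)\<^sup>2 + 2 * Re (cinner x (y :: 'h::complex_hilbert_space))"
  by (simp add: power2_norm_eq_cinner cinner_simps Re_cinner_commute)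

lemma Cauchy_Schwarz_cinner: "cmod (cinner x y) \<le> norm x * norm (y :: 'h::complex_hilbert_space)"
proof (cases "y = 0")
  case False
  define a where "a = cinner x y"
  \<comment> \<open>\<open>z\<close> is the component of \<open>x\<close> orthogonal to
    \<open>y\<close>, multiplied by \<open>(norm y)\<^sup>2\<close> to avoid a division.\<close>
  define z where "z = complex_of_real ((norm y)\<^sup>2) *\<^sub>C x - a *\<^sub>C y"
  have a: "cinner y x = cnj a" unfolding a_def by (rule cinner_commute)
  define s where "s = complex_of_real ((norm y)\<^sup>2)"
  have s: "cnj s = s" "cinner y y = s" by (simp_all add: s_def cinner_self)
  have "cinner z z = s * (s * cinner x x - a * cnj a)"
    unfolding z_def s_def[symmetric] cinner_simps s a a_def[symmetric] by (simp add: algebra_simps)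
  then have "cinner z z = of_real ((norm y)\<^sup>2 * ((norm y)\<^sup>2 * (norm x)\<^sup>2 - (cmod a)\<^sup>2))"
    by (simp add: s_def cinner_self complex_norm_square[symmetric])
  then have "(norm z)\<^sup>2 = (norm y)\<^sup>2 * ((norm y)\<^sup>2 * (norm x)\<^sup>2 - (cmod a)\<^sup>2)"
    unfolding cinner_self using of_real_eq_iff by blast
  then have "0 \<le> (norm y)\<^sup>2 * ((norm y)\<^sup>2 * (norm x)\<^sup>2 - (cmod a)\<^sup>2)"
    by (metis zero_le_power2)
  with False have "(cmod a)\<^sup>2 \<le> (norm x * norm y)\<^sup>2"
    by (simp add: zero_le_mult_iff power_mult_distrib mult.commute)
  then show ?thesis
    unfolding a_def by (rule power2_le_imp_le) simp
qed simp

lemma bounded_bilinear_cinner: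
  "bounded_bilinear (cinner :: 'h::complex_hilbert_space \<Rightarrow> 'h \<Rightarrow> complex)"
proof
  show "\<exists>K. \<forall>x y :: 'h. norm (cinner x y) \<le> norm x * norm y * K"
    by (rule exI[of _ 1]) (simp add: Cauchy_Schwarz_cinner)
qed (simp_all add: cinner_simps scaleR_conv_of_real)

lemmas tendsto_cinner = bounded_bilinear.tendsto[OF bounded_bilinear_cinner]

lemma tendsto_scaleC:
  assumes "(f \<longlongrightarrow> (l :: 'h::complex_hilbert_space)) F"
  shows "((\<lambda>x. c *\<^sub>C f x) \<longlongrightarrow> c *\<^sub>C l) F"
proof (rule bounded_linear.tendsto[OF _ assms])
  show "bounded_linear (\<lambda>x :: 'h. c *\<^sub>C x)"
    by (rule bounded_linear_intro[of _ "cmod c"])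
      (auto simp: scaleR_eq_scaleC scaleC_scaleC mult.commute scaleC_add_right)
qed

lemma cinner_ext_right:
  assumes "\<And>x. cinner x u = cinner x (v :: 'h::complex_hilbert_space)"
  shows "u = v"
proof -
  have "cinner (u - v) (u - v) = 0" by (simp add: cinner_diff_right assms)
  then show ?thesis by simp
qed

section \<open>Riesz representation by minimisation\<close>

lemma nonneg_quadratic_imp_zero:
  fixes a b :: real
  assumes "a \<ge> 0" and nonneg: "\<And>t. 0 \<le> t\<^sup>2 * a + 2 * t * b"
  shows "b = 0"
proof (rule ccontr)
  assume "b \<noteq> 0"
  \<comment> \<open>For \<open>a > 0\<close> the minimiser is \<open>- b / a\<close>; the
    denominator \<open>a + 1\<close> also covers \<open>a = 0\<close>.\<close>
  have "(- b / (a + 1))\<^sup>2 * a + 2 * (- b / (a + 1)) * b = - (b\<^sup>2 * (a + 2) / (a + 1)\<^sup>2)"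
    using \<open>a \<ge> 0\<close> by (simp add: divide_simps power2_eq_square) (simp add: algebra_simps)
  moreover have "b\<^sup>2 * (a + 2) / (a + 1)\<^sup>2 > 0"
    using \<open>a \<ge> 0\<close> \<open>b \<noteq> 0\<close> by simp
  ultimately show False
    using nonneg[of "- b / (a + 1)"] by linarith
qed

text \<open>The representing vector minimises \<open>\<parallel>x\<parallel>\<^sup>2 - 2 Re (f x)\<close>; minimising sequences are Cauchy by
  the parallelogram identity.\<close>

lemma riesz_representation:
  fixes f :: "'h::complex_hilbert_space \<Rightarrow> complex"
  assumes add: "\<And>x y. f (x + y) = f x + f y"
    and scale: "\<And>c x. f (c *\<^sub>C x) = c * f x"
    and bound: "\<And>x. cmod (f x) \<le> K * norm x"
  shows "\<exists>u. \<forall>x. f x = cinner x u"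
proof -
  have scaleR: "f (a *\<^sub>R x) = of_real a * f x" for a x
    by (simp add: scaleR_eq_scaleC scale)
  have blin: "bounded_linear f"
    by (rule bounded_linear_intro[of _ K]) (auto simp: add scaleR bound mult.commute scaleR_conv_of_real)
  define J where "J x = (norm x)\<^sup>2 - 2 * Re (f x)" for x
  have J_ge: "J x \<ge> - K\<^sup>2" for x
  proof -
    have "Re (f x) \<le> K * norm x"
      using bound[of x] complex_Re_le_cmod[of "f x"] by linarith
    moreover have "0 \<le> (norm x - K)\<^sup>2" by simp
    ultimately show ?thesis by (simp add: J_def power2_diff algebra_simps)
  qed
  define m where "m = Inf (range J)"
  have bdd: "bdd_below (range J)"
    by (rule bdd_belowI[of _ "- K\<^sup>2"]) (use J_ge in auto)
  have m_le: "m \<le> J x" for x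
    unfolding m_def by (rule cInf_lower) (use bdd in auto)
  have "\<exists>x. J x < m + 1 / Suc n" for n
    using cInf_lessD[of "range J" "m + 1 / Suc n"] unfolding m_def by auto
  then obtain X where X: "\<And>n. J (X n) < m + 1 / Suc n" by metis
  have par: "(norm (x - y))\<^sup>2 \<le> 2 * J x + 2 * J y - 4 * m" for x y
  proof -
    have "(norm ((1/2) *\<^sub>R (x + y)))\<^sup>2 = (norm (x + y))\<^sup>2 / 4"
      by (simp add: power_mult_distrib power2_eq_square del: scaleR_right_distrib)
    then have "(norm (x - y))\<^sup>2 = 2 * J x + 2 * J y - 4 * J ((1/2) *\<^sub>R (x + y))"
      unfolding J_def scaleR add norm_diff_power2 by (simp add: norm_add_power2 algebra_simps)
    with m_le[of "(1/2) *\<^sub>R (x + y)"] show ?thesis by linarith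
  qed
  have "Cauchy X"
  proof (rule metric_CauchyI)
    fix e :: real assume "e > 0"
    then obtain N where N: "1 / real (Suc N) < e\<^sup>2 / 4"
      using reals_Archimedean[of "e\<^sup>2 / 4"] by (auto simp: inverse_eq_divide)
    have "dist (X i) (X j) < e" if "i \<ge> N" "j \<ge> N" for i j
    proof -
      have near: "J (X k) < m + e\<^sup>2 / 4" if "k \<ge> N" for k
      proof -
        have "1 / real (Suc k) \<le> 1 / real (Suc N)" using that by (simp add: frac_le)
        with N X[of k] show ?thesis by linarith
      qed
      then have "(norm (X i - X j))\<^sup>2 < e\<^sup>2"
        using par[of "X i" "X j"] near[OF that(1)] near[OF that(2)] by linarith
      then show ?thesis
        using \<open>e > 0\<close> by (simp add: dist_norm power_less_imp_less_base)
    qed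
    then show "\<exists>M. \<forall>i\<ge>M. \<forall>j\<ge>M. dist (X i) (X j) < e" by blast
  qed
  then obtain u where u: "X \<longlonglongrightarrow> u"
    using Cauchy_convergent convergent_def by blast
  have "(\<lambda>n. J (X n)) \<longlonglongrightarrow> J u"
    unfolding J_def by (intro tendsto_intros u bounded_linear.tendsto[OF blin])
  moreover have "(\<lambda>n. m + 1 / Suc n) \<longlonglongrightarrow> m + 0"
    by (intro tendsto_add tendsto_const LIMSEQ_Suc[OF lim_1_over_n])
  ultimately have "J u \<le> m + 0"
    by (rule LIMSEQ_le) (use X less_imp_le in blast)
  then have min: "J u \<le> J x" for x using m_le[of x] by simp
  \<comment> \<open>First variation: along \<open>u + t *\<^sub>R h\<close>, minimality of
    \<open>u\<close> says that a quadratic in \<open>t\<close> without constant term is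
    nonnegative.\<close>
  have Re: "Re (f h) = Re (cinner h u)" for h
  proof -
    have "0 \<le> t\<^sup>2 * (norm h)\<^sup>2 + 2 * t * (Re (cinner h u) - Re (f h))" for t
      using min[of "u + t *\<^sub>R h"] unfolding J_def norm_add_power2 add scaleR
      by (simp add: cinner_simps power_mult_distrib Re_cinner_commute[of h u] algebra_simps)
    then have "Re (cinner h u) - Re (f h) = 0"
      by (intro nonneg_quadratic_imp_zero[of "(norm h)\<^sup>2"]) auto
    then show ?thesis by simp
  qed
  \<comment> \<open>Real parts suffice, because the real part of \<open>f (\<i> *\<^sub>C x)\<close>
    is minus the imaginary part of \<open>f x\<close>.\<close>
  have "f x = cinner x u" for x
    using Re[of x] Re[of "\<i> *\<^sub>C x"] by (simp add: complex_eq_iff scale cinner_simps)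
  then show ?thesis by blast
qed


section \<open>Bounded operators and adjoints\<close>

lemma bounded_ops_scaleC: "A \<in> bounded_ops \<Longrightarrow> blinfun_apply A (c *\<^sub>C x) = c *\<^sub>C blinfun_apply A x"
  by (simp add: bounded_ops_def)

lemma bounded_opsE:
  fixes f :: "'h::complex_hilbert_space \<Rightarrow> 'h"
  assumes "\<And>x y. f (x + y) = f x + f y" and "\<And>c x. f (c *\<^sub>C x) = c *\<^sub>C f x"
    and "\<And>x. norm (f x) \<le> K * norm x"
  obtains F where "F \<in> bounded_ops" and "blinfun_apply F = f"
proof -
  have "bounded_linear f"
    by (rule bounded_linear_intro[of _ K]) (auto simp: assms scaleR_eq_scaleC mult.commute)
  then have "blinfun_apply (Blinfun f) = f" by (rule bounded_linear_Blinfun_apply)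
  with assms(2) that[of "Blinfun f"] show ?thesis by (simp add: bounded_ops_def)
qed

lemma bounded_ops_id [simp]: "id_blinfun \<in> bounded_ops"
  by (simp add: bounded_ops_def)

lemma bounded_ops_zero [simp]: "0 \<in> bounded_ops"
  by (simp add: bounded_ops_def)

lemma bounded_ops_compose: "A \<in> bounded_ops \<Longrightarrow> B \<in> bounded_ops \<Longrightarrow> A o\<^sub>L B \<in> bounded_ops"
  by (simp add: bounded_ops_def)

lemma bounded_ops_add: "A \<in> bounded_ops \<Longrightarrow> B \<in> bounded_ops \<Longrightarrow> A + B \<in> bounded_ops"
  by (simp add: bounded_ops_def blinfun.add_left scaleC_add_right)

lemma bounded_ops_diff: "A \<in> bounded_ops \<Longrightarrow> B \<in> bounded_ops \<Longrightarrow> A - B \<in> bounded_ops"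
  by (simp add: bounded_ops_def blinfun.diff_left scaleC.scale_right_diff_distrib)

lemma bounded_ops_scaleR: "A \<in> bounded_ops \<Longrightarrow> a *\<^sub>R A \<in> bounded_ops"
  by (simp add: bounded_ops_def blinfun.scaleR_left scaleR_eq_scaleC mult.commute)

lemma bounded_ops_tendsto:
  assumes "\<And>n. F n \<in> bounded_ops" and "F \<longlonglongrightarrow> B"
  shows "B \<in> bounded_ops"
proof -
  have lim: "(\<lambda>n. blinfun_apply (F n) x) \<longlonglongrightarrow> blinfun_apply B x" for x
    by (intro blinfun.tendsto assms tendsto_const)
  have "blinfun_apply B (c *\<^sub>C x) = c *\<^sub>C blinfun_apply B x" for c x
    using lim[of "c *\<^sub>C x"] tendsto_scaleC[OF lim[of x], of c]
    by (simp add: bounded_ops_scaleC[OF assms(1)] LIMSEQ_unique)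
  then show ?thesis by (simp add: bounded_ops_def)
qed

section \<open>Adjoints\<close>

lemma op_adjoint_eqI:
  assumes "\<And>x y. cinner (blinfun_apply A x) y = cinner x (blinfun_apply B y)"
  shows "op_adjoint A = B"
  unfolding op_adjoint_def
proof (rule the_equality)
  fix B' assume "\<forall>x y. cinner (blinfun_apply A x) y = cinner x (blinfun_apply B' y)"
  then have "cinner x (blinfun_apply B' y) = cinner x (blinfun_apply B y)" for x y
    by (metis assms)
  then show "B' = B" by (intro blinfun_eqI cinner_ext_right)
qed (use assms in blast)

text \<open>Riesz representation is applied, for each \<open>y\<close>, to the functional sending
  \<open>x\<close> to \<langle>A x, y\<rangle>. Uniqueness of the representing vector makes
  \<open>g\<close> linear, and inserting \<open>x = g y\<close> bounds it.\<close>

lemma adjoint_exists: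
  assumes A: "A \<in> bounded_ops"
  shows "\<exists>B\<in>bounded_ops. \<forall>x y. cinner (blinfun_apply A x) y = cinner x (blinfun_apply B y)"
proof -
  have bd: "cmod (cinner (blinfun_apply A x) y) \<le> (norm A * norm y) * norm x" for x y
  proof -
    have "cmod (cinner (blinfun_apply A x) y) \<le> norm (blinfun_apply A x) * norm y"
      by (rule Cauchy_Schwarz_cinner)
    also have "\<dots> \<le> (norm A * norm x) * norm y"
      by (intro mult_right_mono norm_blinfun) simp
    finally show ?thesis by (simp add: mult_ac)
  qed
  have "\<exists>u. \<forall>x. cinner (blinfun_apply A x) y = cinner x u" for y
    by (rule riesz_representation[of _ "norm A * norm y"])
      (simp_all add: bd blinfun.add_right cinner_simps bounded_ops_scaleC[OF A])
  then obtain g where g: "\<And>x y. cinner (blinfun_apply A x) y = cinner x (g y)" by metis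
  have add: "g (x + y) = g x + g y" for x y
    by (rule cinner_ext_right) (simp add: g[symmetric] cinner_simps)
  have scale: "g (c *\<^sub>C x) = c *\<^sub>C g x" for c x
    by (rule cinner_ext_right) (simp add: g[symmetric] cinner_simps)
  have bound: "norm (g y) \<le> norm A * norm y" for y
  proof (cases "g y = 0")
    case False
    have "norm (g y) * norm (g y) = cmod (cinner (blinfun_apply A (g y)) y)"
      unfolding g cinner_self by (simp add: power2_eq_square norm_mult)
    with bd[of "g y" y] have "norm (g y) * norm (g y) \<le> (norm A * norm y) * norm (g y)" by simp
    with False show ?thesis by simp
  qed simp
  obtain B where "B \<in> bounded_ops" "blinfun_apply B = g"
    using bounded_opsE[OF add scale bound] .
  with g show ?thesis by metis
qed

lemma
  assumes "A \<in> bounded_ops"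
  shows op_adjoint_in [simp]: "op_adjoint A \<in> bounded_ops"
    and cinner_op_adjoint: "cinner (blinfun_apply A x) y = cinner x (blinfun_apply (op_adjoint A) y)"
  using adjoint_exists[OF assms] op_adjoint_eqI by metis+

text \<open>Polarisation; this needs complex scalars.\<close>

lemma quadratic_form_zero_imp_zero:
  assumes A: "A \<in> bounded_ops" and zero: "\<And>x. cinner (blinfun_apply A x) x = 0"
  shows "A = 0"
proof (rule blinfun_eqI)
  fix x
  have "cinner (blinfun_apply A x) y = 0" for y
  proof -
    have "cinner (blinfun_apply A x) y + cinner (blinfun_apply A y) x = 0"
      using zero[of "x + y"] zero[of x] zero[of y] by (simp add: blinfun.add_right cinner_simps add.commute)
    \<comment> \<open>With \<open>\<i> *\<^sub>C y\<close> in place of \<open>y\<close> the two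
      cross terms enter with opposite signs, so both vanish.\<close>
    moreover have "- \<i> * cinner (blinfun_apply A x) y + \<i> * cinner (blinfun_apply A y) x = 0"
      using zero[of "x + \<i> *\<^sub>C y"] zero[of x] zero[of y]
      by (simp add: blinfun.add_right cinner_simps bounded_ops_scaleC[OF A])
    ultimately show ?thesis by (auto simp: complex_eq_iff)
  qed
  then have "cinner (blinfun_apply A x) (blinfun_apply A x) = 0" .
  then show "blinfun_apply A x = blinfun_apply 0 x" by simp
qed

text \<open>Lax--Milgram: the solution of \<open>M x = y\<close> is the fixed point of the contraction
  \<open>x \<mapsto> x - \<epsilon> (M x - y)\<close> for small \<open>\<epsilon>\<close>.\<close>

lemma coercive_invertible:
  fixes M :: "'h::complex_hilbert_space \<Rightarrow>\<^sub>L 'h"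
  assumes M: "M \<in> bounded_ops" and "\<delta> > 0"
    and coercive: "\<And>x. \<delta> * (norm x)\<^sup>2 \<le> Re (cinner (blinfun_apply M x) x)"
  shows "\<exists>B\<in>bounded_ops. \<forall>x. blinfun_apply B (blinfun_apply M x) = x \<and>
    blinfun_apply M (blinfun_apply B x) = x"
proof -
  \<comment> \<open>Adding \<open>\<delta>\<close> makes \<open>K\<close> positive and ensures
    \<open>\<delta> \<le> K\<close>, so that the square root in \<open>c\<close> has a nonnegative
    argument.\<close>
  define K where "K = norm M + \<delta>"
  have K: "K > 0" "norm M \<le> K" "\<delta> \<le> K" using \<open>\<delta> > 0\<close> by (simp_all add: K_def add_nonneg_pos)
  \<comment> \<open>This value minimises \<open>1 - 2 * \<epsilon> * \<delta> + \<epsilon>\<^sup>2 *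
    K\<^sup>2\<close>, the bound for the squared contraction factor; the minimum is
    \<open>c\<^sup>2\<close>.\<close>
  define \<epsilon> where "\<epsilon> = \<delta> / K\<^sup>2"
  define c where "c = sqrt (1 - \<delta>\<^sup>2 / K\<^sup>2)"
  have "\<delta>\<^sup>2 \<le> K\<^sup>2" using K \<open>\<delta> > 0\<close> by (intro power_mono) auto
  then have c2: "0 \<le> 1 - \<delta>\<^sup>2 / K\<^sup>2" "1 - \<delta>\<^sup>2 / K\<^sup>2 < 1"
    using K \<open>\<delta> > 0\<close> by (simp_all add: divide_simps)
  have "\<epsilon> \<ge> 0" using \<open>\<delta> > 0\<close> by (simp add: \<epsilon>_def)
  have contr: "norm (z - \<epsilon> *\<^sub>R blinfun_apply M z) \<le> c * norm z" for z
  proof (rule power2_le_imp_le)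
    have "norm (blinfun_apply M z) \<le> K * norm z"
      using norm_blinfun[of M z] mult_right_mono[OF K(2) norm_ge_zero[of z]] by linarith
    then have "(norm (blinfun_apply M z))\<^sup>2 \<le> (K * norm z)\<^sup>2"
      by (rule power_mono) simp
    then have 1: "\<epsilon>\<^sup>2 * (norm (blinfun_apply M z))\<^sup>2 \<le> \<epsilon>\<^sup>2 * (K * norm z)\<^sup>2"
      by (rule mult_left_mono) simp
    have 2: "\<epsilon> * (\<delta> * (norm z)\<^sup>2) \<le> \<epsilon> * Re (cinner (blinfun_apply M z) z)"
      using coercive[of z] \<open>\<epsilon> \<ge> 0\<close> by (rule mult_left_mono)
    have "(norm (z - \<epsilon> *\<^sub>R blinfun_apply M z))\<^sup>2 = (norm z)\<^sup>2
       + \<epsilon>\<^sup>2 * (norm (blinfun_apply M z))\<^sup>2 - 2 * (\<epsilon> * Re (cinner (blinfun_apply M z) z))"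
      by (simp add: norm_diff_power2 cinner_simps power_mult_distrib
          Re_cinner_commute[of "blinfun_apply M z" z])
    also have "\<dots> \<le> (norm z)\<^sup>2 + \<epsilon>\<^sup>2 * (K * norm z)\<^sup>2 - 2 * (\<epsilon> * (\<delta> * (norm z)\<^sup>2))"
      using 1 2 by linarith
    also have "\<dots> = (1 - \<delta>\<^sup>2 / K\<^sup>2) * (norm z)\<^sup>2"
      using K by (simp add: \<epsilon>_def divide_simps power2_eq_square) (simp add: algebra_simps)
    also have "\<dots> = (c * norm z)\<^sup>2"
      using c2 by (simp add: c_def power_mult_distrib)
    finally show "(norm (z - \<epsilon> *\<^sub>R blinfun_apply M z))\<^sup>2 \<le> (c * norm z)\<^sup>2" .
    show "0 \<le> c * norm z" using c2 by (simp add: c_def)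
  qed
  have "\<exists>x. blinfun_apply M x = y" for y
  proof -
    define g where "g x = x - \<epsilon> *\<^sub>R (blinfun_apply M x - y)" for x
    have "dist (g x) (g x') \<le> c * dist x x'" for x x'
    proof -
      have "g x - g x' = (x - x') - \<epsilon> *\<^sub>R blinfun_apply M (x - x')"
        by (simp add: g_def blinfun.diff_right algebra_simps)
      with contr[of "x - x'"] show ?thesis by (simp add: dist_norm)
    qed
    then have "\<exists>!x\<in>UNIV. g x = x"
      using c2 by (intro Banach_fix[of _ c]) (auto simp: c_def complete_UNIV)
    then obtain x where "g x = x" by blast
    moreover have "\<epsilon> \<noteq> 0" using K \<open>\<delta> > 0\<close> by (simp add: \<epsilon>_def)
    ultimately show ?thesis by (auto simp: g_def)
  qed
  then obtain b where b: "\<And>y. blinfun_apply M (b y) = y" by metis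
  \<comment> \<open>Coercivity and Cauchy-Schwarz bound \<open>M\<close> below; this gives
    injectivity and the norm bound of the inverse.\<close>
  have lower: "\<delta> * norm x \<le> norm (blinfun_apply M x)" for x
  proof (cases "x = 0")
    case False
    have "\<delta> * (norm x)\<^sup>2 \<le> norm (blinfun_apply M x) * norm x"
      using coercive[of x] complex_Re_le_cmod[of "cinner (blinfun_apply M x) x"]
        Cauchy_Schwarz_cinner[of "blinfun_apply M x" x] by linarith
    with False show ?thesis by (simp add: power2_eq_square)
  qed simp
  have inj: "x = y" if "blinfun_apply M x = blinfun_apply M y" for x y
    using lower[of "x - y"] that \<open>\<delta> > 0\<close> by (simp add: blinfun.diff_right mult_le_0_iff)
  have bound: "norm (b y) \<le> (1 / \<delta>) * norm y" for y
    using lower[of "b y"] \<open>\<delta> > 0\<close> by (simp add: b divide_simps mult.commute)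
  obtain B where "B \<in> bounded_ops" "blinfun_apply B = b"
  proof (rule bounded_opsE[OF _ _ bound])
    show "b (x + y) = b x + b y" for x y by (rule inj) (simp add: blinfun.add_right b)
    show "b (c *\<^sub>C x) = c *\<^sub>C b x" for c x by (rule inj) (simp add: bounded_ops_scaleC[OF M] b)
  qed
  moreover have "b (blinfun_apply M x) = x" for x by (rule inj) (rule b)
  ultimately show ?thesis using b by metis
qed

section \<open>Polynomials of operators\<close>

lemma op_poly_atMost:
  assumes "degree p \<le> n"
  shows "op_poly p A = (\<Sum>i\<le>n. coeff p i *\<^sub>R (((o\<^sub>L) A ^^ i) id_blinfun))"
  unfolding op_poly_def
  by (rule sum.mono_neutral_left) (use assms in \<open>auto simp: coeff_eq_0 not_le\<close>)

lemma op_poly_0 [simp]: "op_poly 0 A = 0"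
  by (simp add: op_poly_def)

text \<open>Horner's rule; it opens the way to induction over \<open>pCons\<close>.\<close>

lemma op_poly_pCons [simp]: "op_poly (pCons a p) A = a *\<^sub>R id_blinfun + (A o\<^sub>L op_poly p A)"
proof -
  have "op_poly (pCons a p) A =
      (\<Sum>i\<le>Suc (degree p). coeff (pCons a p) i *\<^sub>R (((o\<^sub>L) A ^^ i) id_blinfun))"
    by (rule op_poly_atMost) (simp add: degree_pCons_le)
  also have "\<dots> = a *\<^sub>R id_blinfun +
      (\<Sum>i\<le>degree p. coeff p i *\<^sub>R (A o\<^sub>L (((o\<^sub>L) A ^^ i) id_blinfun)))"
    by (simp add: sum.atMost_Suc_shift del: sum.atMost_Suc)
  also have "(\<Sum>i\<le>degree p. coeff p i *\<^sub>R (A o\<^sub>L (((o\<^sub>L) A ^^ i) id_blinfun))) = A o\<^sub>L op_poly p A"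
    unfolding op_poly_def bounded_bilinear.sum_right[OF bounded_bilinear_blinfun_compose]
    by (simp add: bounded_bilinear.scaleR_right[OF bounded_bilinear_blinfun_compose])
  finally show ?thesis .
qed

lemma op_poly_1 [simp]: "op_poly 1 A = id_blinfun"
  using op_poly_pCons[of 1 0 A] by (simp add: one_pCons)

lemma op_poly_add: "op_poly (p + q) A = op_poly p A + op_poly q A"
proof (induction p q rule: poly_induct2)
  case (pCons a p b q)
  then show ?case
    by (simp add: scaleR_left_distrib bounded_bilinear.add_right[OF bounded_bilinear_blinfun_compose])
qed simp

lemma op_poly_smult: "op_poly (smult c p) A = c *\<^sub>R op_poly p A"
  by (induction p)
    (simp_all add: scaleR_right_distrib bounded_bilinear.scaleR_right[OF bounded_bilinear_blinfun_compose])

lemma op_poly_diff: "op_poly (p - q) A = op_poly p A - op_poly q A"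
  using op_poly_add[of p "smult (-1) q" A] op_poly_smult[of "-1" q A] by simp

lemma op_poly_mult: "op_poly (p * q) A = op_poly p A o\<^sub>L op_poly q A"
proof (induction p)
  case (pCons a p)
  show ?case
    by (rule blinfun_eqI)
      (simp add: op_poly_add op_poly_smult pCons.IH blinfun.add_left blinfun.scaleR_left)
qed simp

lemma op_poly_in: "A \<in> bounded_ops \<Longrightarrow> op_poly p A \<in> bounded_ops"
  by (induction p) (simp_all add: bounded_ops_add bounded_ops_scaleR bounded_ops_compose)

lemma op_poly_mult_apply: "blinfun_apply (op_poly (p * q) A) x = blinfun_apply (op_poly p A) (blinfun_apply (op_poly q A) x)"
  by (simp add: op_poly_mult)

lemma op_poly_commute:
  "blinfun_apply (op_poly p A) (blinfun_apply A x) = blinfun_apply A (blinfun_apply (op_poly p A) x)"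
  using op_poly_mult_apply[of p "[:0, 1:]" A x] op_poly_mult_apply[of "[:0, 1:]" p A x]
  by (simp only: mult.commute[of p]) (simp add: blinfun.add_left)


section \<open>The functional calculus\<close>

definition self_adjoint_op :: "('h::complex_hilbert_space \<Rightarrow>\<^sub>L 'h) \<Rightarrow> bool" where
  "self_adjoint_op N \<longleftrightarrow> N \<in> bounded_ops \<and>
     (\<forall>x y. cinner (blinfun_apply N x) y = cinner x (blinfun_apply N y))"

text \<open>For self-adjoint \<open>N\<close> the number \<langle>N x, x\<rangle> is real, so the
  real part loses nothing.\<close>

definition positive_op :: "('h::complex_hilbert_space \<Rightarrow>\<^sub>L 'h) \<Rightarrow> bool" where
  "positive_op N \<longleftrightarrow> self_adjoint_op N \<and> (\<forall>x. 0 \<le> Re (cinner (blinfun_apply N x) x))"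

abbreviation real_spectrum :: "('h::complex_hilbert_space \<Rightarrow>\<^sub>L 'h) \<Rightarrow> real set" where
  "real_spectrum N \<equiv> {t. complex_of_real t \<in> op_spectrum N}"

lemma self_adjoint_opD:
  assumes "self_adjoint_op N"
  shows "N \<in> bounded_ops" and "cinner (blinfun_apply N x) y = cinner x (blinfun_apply N y)"
  using assms by (auto simp: self_adjoint_op_def)

lemma positive_opD:
  assumes "positive_op N"
  shows "self_adjoint_op N" and "N \<in> bounded_ops" and "0 \<le> Re (cinner (blinfun_apply N x) x)"
  using assms by (auto simp: self_adjoint_op_def positive_op_def)

lemma self_adjoint_op_poly:
  assumes "self_adjoint_op N"
  shows "self_adjoint_op (op_poly p N)"
proof -
  have "cinner (blinfun_apply (op_poly p N) x) y = cinner x (blinfun_apply (op_poly p N) y)" for x y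
    by (induction p arbitrary: x y)
      (simp_all add: blinfun.add_left blinfun.scaleR_left cinner_simps
        self_adjoint_opD[OF assms] op_poly_commute)
  then show ?thesis
    by (simp add: self_adjoint_op_def op_poly_in self_adjoint_opD[OF assms])
qed

lemma self_adjoint_square_norm:
  assumes "self_adjoint_op N"
  shows "cinner (blinfun_apply N (blinfun_apply N x)) x = of_real ((norm (blinfun_apply N x))\<^sup>2)"
  using self_adjoint_opD(2)[OF assms, of "blinfun_apply N x" x] by (simp add: cinner_self)

section \<open>Spectra of positive operators\<close>

lemma not_in_op_spectrumI:
  assumes "B \<in> bounded_ops"
    and "\<And>x. blinfun_apply B (blinfun_apply A x - c *\<^sub>C x) = x"
    and "\<And>x. blinfun_apply A (blinfun_apply B x) - c *\<^sub>C blinfun_apply B x = x"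
  shows "c \<notin> op_spectrum A"
  using assms unfolding op_spectrum_def by blast

lemma eigenvalue_in_op_spectrum:
  assumes "blinfun_apply A x = c *\<^sub>C x" and "x \<noteq> 0"
  shows "c \<in> op_spectrum A"
proof (rule ccontr)
  assume "c \<notin> op_spectrum A"
  then obtain B where "blinfun_apply B (blinfun_apply A x - c *\<^sub>C x) = x"
    unfolding op_spectrum_def by blast
  with assms show False by (simp add: blinfun.zero_right)
qed

text \<open>For \<open>t\<close> outside the interval, \<open>N - t\<close> or its negative is
  coercive, hence invertible by \<open>coercive_invertible\<close>.\<close>

lemma real_spectrum_positive_op:
  assumes N: "positive_op N"
  shows "real_spectrum N \<subseteq> {0..norm N}"
proof -
  have "0 \<le> t \<and> t \<le> norm N" if t: "complex_of_real t \<in> op_spectrum N" for t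
  proof (rule ccontr)
    assume "\<not> (0 \<le> t \<and> t \<le> norm N)"
    \<comment> \<open>\<open>\<sigma>\<close> is the sign that makes
      \<open>\<sigma> * (N - t)\<close> coercive, and \<open>\<delta>\<close> is the distance of
      \<open>t\<close> from the interval.\<close>
    then obtain \<sigma> :: real and \<delta> where \<sigma>: "\<sigma> * \<sigma> = 1" and "\<delta> > 0"
      and coercive: "\<And>x. \<delta> * (norm x)\<^sup>2 \<le> Re (cinner (blinfun_apply (\<sigma> *\<^sub>R (N - t *\<^sub>R id_blinfun)) x) x)"
    proof (cases "t < 0")
      case True
      show thesis
      proof (rule that[of 1 "- t"])
        show "- t * (norm x)\<^sup>2 \<le> Re (cinner (blinfun_apply (1 *\<^sub>R (N - t *\<^sub>R id_blinfun)) x) x)" for x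
          using positive_opD(3)[OF N, of x]
          by (simp add: blinfun.diff_left blinfun.scaleR_left cinner_simps cinner_self)
      qed (use True in auto)
    next
      case False
      have le: "Re (cinner (blinfun_apply N x) x) \<le> norm N * (norm x)\<^sup>2" for x
      proof -
        have "Re (cinner (blinfun_apply N x) x) \<le> norm (blinfun_apply N x) * norm x"
          using Cauchy_Schwarz_cinner[of "blinfun_apply N x" x] complex_Re_le_cmod[of "cinner (blinfun_apply N x) x"]
          by linarith
        also have "\<dots> \<le> (norm N * norm x) * norm x"
          by (intro mult_right_mono norm_blinfun) simp
        finally show ?thesis by (simp add: power2_eq_square mult.assoc)
      qed
      show thesis
      proof (rule that[of "-1" "t - norm N"])
        show "(t - norm N) * (norm x)\<^sup>2 \<le> Re (cinner (blinfun_apply ((-1) *\<^sub>R (N - t *\<^sub>R id_blinfun)) x) x)" for x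
          using le[of x]
          by (simp add: blinfun.diff_left blinfun.minus_left blinfun.scaleR_left cinner_simps cinner_self algebra_simps)
      qed (use False \<open>\<not> (0 \<le> t \<and> t \<le> norm N)\<close> in auto)
    qed
    define M where "M = \<sigma> *\<^sub>R (N - t *\<^sub>R id_blinfun)"
    have M: "M \<in> bounded_ops"
      unfolding M_def by (intro bounded_ops_scaleR bounded_ops_diff bounded_ops_id positive_opD(2)[OF N])
    obtain B where B: "B \<in> bounded_ops" "\<And>x. blinfun_apply B (blinfun_apply M x) = x"
        "\<And>x. blinfun_apply M (blinfun_apply B x) = x"
      using coercive_invertible[OF M \<open>\<delta> > 0\<close>] coercive unfolding M_def by blast
    have M_apply: "blinfun_apply M x = \<sigma> *\<^sub>R (blinfun_apply N x - t *\<^sub>R x)" for x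
      by (simp add: M_def blinfun.diff_left blinfun.scaleR_left)
    have "complex_of_real t \<notin> op_spectrum N"
    \<comment> \<open>As \<open>\<sigma> * \<sigma> = 1\<close>, an inverse of \<open>M\<close>
      multiplied by \<open>\<sigma>\<close> is an inverse of \<open>N - t\<close>.\<close>
    proof (rule not_in_op_spectrumI[of "\<sigma> *\<^sub>R B"])
      show "\<sigma> *\<^sub>R B \<in> bounded_ops" by (intro bounded_ops_scaleR B)
      show "blinfun_apply (\<sigma> *\<^sub>R B) (blinfun_apply N x - complex_of_real t *\<^sub>C x) = x" for x
        using B(2)[of x] by (simp add: M_apply blinfun.scaleR_left blinfun.scaleR_right scaleC_of_real)
      show "blinfun_apply N (blinfun_apply (\<sigma> *\<^sub>R B) x)
          - complex_of_real t *\<^sub>C blinfun_apply (\<sigma> *\<^sub>R B) x = x" for x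
        using B(3)[of x]
        by (simp add: M_apply blinfun.scaleR_left blinfun.scaleR_right scaleC_of_real algebra_simps)
    qed
    with t show False by contradiction
  qed
  then show ?thesis by auto
qed

section \<open>Real polynomials at complex points\<close>

definition cpoly :: "real poly \<Rightarrow> complex \<Rightarrow> complex" where
  "cpoly p z = poly (map_poly of_real p) z"

lemma cpoly_simps [simp]: "cpoly 0 z = 0" "cpoly (pCons a p) z = of_real a + z * cpoly p z"
  by (simp_all add: cpoly_def map_poly_pCons)

lemma cpoly_add: "cpoly (p + q) z = cpoly p z + cpoly q z"
  by (induction p q rule: poly_induct2) (simp_all add: algebra_simps)

lemma cpoly_smult: "cpoly (smult c p) z = of_real c * cpoly p z"
  by (induction p) (simp_all add: algebra_simps)

lemma cpoly_mult: "cpoly (p * q) z = cpoly p z * cpoly q z"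
  by (induction p) (simp_all add: cpoly_add cpoly_smult algebra_simps)

lemma cpoly_of_real: "cpoly p (of_real t) = of_real (poly p t)"
  by (induction p) simp_all

lemma degree_le_oneE:
  assumes "degree p \<le> 1"
  obtains a b where "p = [:a, b:]"
proof
  show "p = [:coeff p 0, coeff p 1:]"
    by (rule poly_eqI) (use assms in \<open>auto simp: coeff_pCons coeff_eq_0 split: nat.split\<close>)
qed

text \<open>A complex root exists by the fundamental theorem of algebra. A real root splits off a
  linear factor; a nonreal one, paired with its conjugate, splits off a real quadratic.\<close>

lemma real_poly_factor:
  fixes q :: "real poly"
  assumes "degree q > 0"
  obtains (linear) t q' where "q = [:- t, 1:] * q'"
    | (quadratic) a b q' where "b \<noteq> 0" "q = [:a\<^sup>2 + b\<^sup>2, - 2 * a, 1:] * q'"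
proof -
  have "degree (map_poly complex_of_real q) = degree q"
    by (rule degree_map_poly) simp
  then have "\<exists>z. cpoly q z = 0"
    unfolding cpoly_def using assms by (intro alg_closed_imp_poly_has_root) simp
  then obtain z where z: "cpoly q z = 0" ..
  show thesis
  proof (cases "Im z = 0")
    case True
    then have "z = of_real (Re z)" by (simp add: complex_eq_iff)
    then have "poly q (Re z) = 0" using z cpoly_of_real[of q "Re z"] by simp
    then show thesis using linear by (auto simp: poly_eq_0_iff_dvd dvd_def)
  next
    case False
    \<comment> \<open>\<open>w\<close> is the product of \<open>X - z\<close> and
      \<open>X - cnj z\<close>.\<close>
    define w where "w = [:(Re z)\<^sup>2 + (Im z)\<^sup>2, - 2 * Re z, 1:]"
    have deg: "degree w = 2" by (simp add: w_def)
    have wz: "cpoly w z = 0"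
      by (simp add: w_def complex_eq_iff power2_eq_square algebra_simps)
    have "w \<noteq> 0" by (simp add: w_def)
    then have "q mod w = 0 \<or> degree (q mod w) < 2"
      using degree_mod_less[of w q] deg by simp
    then have "degree (q mod w) \<le> 1" by auto
    then obtain a b where r: "q mod w = [:a, b:]" by (rule degree_le_oneE)
    have "cpoly q z = cpoly (w * (q div w) + q mod w) z" by simp
    then have "cpoly [:a, b:] z = 0"
      using z unfolding cpoly_add cpoly_mult r wz by simp
    \<comment> \<open>The remainder is real of degree at most one and vanishes at the nonreal point
      \<open>z\<close>, so both coefficients are zero.\<close>
    then have "b * Im z = 0" "a + Re z * b = 0" by (simp_all add: complex_eq_iff mult.commute)
    with False have "q mod w = 0" by (simp add: r)
    then have "q = w * (q div w)" by (metis add.right_neutral mult_div_mod_eq)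
    then show thesis using quadratic[OF False, of "Re z" "q div w"] unfolding w_def by blast
  qed
qed

text \<open>Linear real factors \<open>X - t\<close> are invertible at \<open>N\<close>; quadratic ones \<open>(X - a)\<^sup>2 + b\<^sup>2\<close> are
  bounded below by \<open>b\<^sup>2\<close> because \<open>N\<close> is self-adjoint.\<close>

lemma op_poly_bounded_below:
  assumes N: "self_adjoint_op N" and "q \<noteq> 0"
    and no_root: "\<And>t. t \<in> real_spectrum N \<Longrightarrow> poly q t \<noteq> 0"
  shows "\<exists>\<delta>>0. \<forall>x. \<delta> * norm x \<le> norm (blinfun_apply (op_poly q N) x)"
  using \<open>q \<noteq> 0\<close> no_root
proof (induction "degree q" arbitrary: q rule: less_induct)
  case less
  \<comment> \<open>Lower bounds multiply: once a factor \<open>w\<close> is bounded below, the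
    induction hypothesis handles the cofactor of smaller degree.\<close>
  have step: ?case
    if q: "q = w * q'" and "degree w > 0" and "\<gamma> > 0"
      and w: "\<And>x. \<gamma> * norm x \<le> norm (blinfun_apply (op_poly w N) x)" for w q' \<gamma>
  proof -
    have "q' \<noteq> 0" "w \<noteq> 0" using \<open>q \<noteq> 0\<close> q by auto
    then have "degree q' < degree q" using \<open>degree w > 0\<close> by (simp add: q degree_mult_eq)
    moreover have "poly q' t \<noteq> 0" if "t \<in> real_spectrum N" for t
      using less.prems(2)[OF that] by (simp add: q)
    ultimately obtain \<delta> where "\<delta> > 0"
      and \<delta>: "\<And>x. \<delta> * norm x \<le> norm (blinfun_apply (op_poly q' N) x)"
      using less.hyps \<open>q' \<noteq> 0\<close> by blast
    have "(\<gamma> * \<delta>) * norm x \<le> norm (blinfun_apply (op_poly q N) x)" for x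
      using mult_left_mono[OF \<delta>[of x], of \<gamma>] w[of "blinfun_apply (op_poly q' N) x"] \<open>\<gamma> > 0\<close>
      unfolding q op_poly_mult_apply mult.assoc by (smt (verit))
    with \<open>\<gamma> > 0\<close> \<open>\<delta> > 0\<close> show ?thesis by (meson mult_pos_pos)
  qed
  show ?case
  proof (cases "degree q = 0")
    case True
    then obtain c where "q = [:c:]" by (rule degree_eq_zeroE)
    with less.prems(1) show ?thesis
      by (intro exI[of _ "\<bar>c\<bar>"]) (auto simp: blinfun.add_left blinfun.scaleR_left)
  next
    case False
    then have "degree q > 0" by simp
    then show ?thesis
    proof (cases rule: real_poly_factor)
      case (linear t q')
      have "poly q t = 0" by (simp add: linear)
      then have "complex_of_real t \<notin> op_spectrum N" using less.prems(2) by blast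
      then obtain B where B: "\<And>x. blinfun_apply B (blinfun_apply N x - complex_of_real t *\<^sub>C x) = x"
        unfolding op_spectrum_def by blast
      have w: "blinfun_apply (op_poly [:- t, 1:] N) x = blinfun_apply N x - complex_of_real t *\<^sub>C x" for x
        by (simp add: blinfun.add_left blinfun.diff_left blinfun.scaleR_left scaleC_of_real)
      \<comment> \<open>The summand 1 keeps the constant positive even if
        \<open>norm B = 0\<close>.\<close>
      have "(1 / (norm B + 1)) * norm x \<le> norm (blinfun_apply (op_poly [:- t, 1:] N) x)" for x
      proof -
        have "norm x \<le> norm B * norm (blinfun_apply (op_poly [:- t, 1:] N) x)"
          using norm_blinfun[of B "blinfun_apply (op_poly [:- t, 1:] N) x"] unfolding w B .
        also have "\<dots> \<le> (norm B + 1) * norm (blinfun_apply (op_poly [:- t, 1:] N) x)"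
          by (intro mult_right_mono) simp_all
        finally show ?thesis
          by (simp add: divide_simps add_nonneg_pos mult.commute del: op_poly_pCons)
      qed
      then show ?thesis
        by (intro step[OF linear, of "1 / (norm B + 1)"]) (simp_all add: add_nonneg_pos)
    next
      case (quadratic a b q')
      let ?w = "[:a\<^sup>2 + b\<^sup>2, - 2 * a, 1:]"
      have fact: "?w = [:- a, 1:] * [:- a, 1:] + [:b\<^sup>2:]" by (simp add: power2_eq_square)
      have sa: "self_adjoint_op (op_poly [:- a, 1:] N)" by (rule self_adjoint_op_poly[OF N])
      have "b\<^sup>2 * norm x \<le> norm (blinfun_apply (op_poly ?w N) x)" for x
      proof (cases "x = 0")
        case False
        have "cinner (blinfun_apply (op_poly ?w N) x) x =
            of_real ((norm (blinfun_apply (op_poly [:- a, 1:] N) x))\<^sup>2 + b\<^sup>2 * (norm x)\<^sup>2)"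
          unfolding fact op_poly_add op_poly_mult blinfun.add_left blinfun_apply_blinfun_compose cinner_add_left
            self_adjoint_square_norm[OF sa]
          by (simp add: blinfun.add_left blinfun.scaleR_left cinner_simps cinner_self)
        then have "b\<^sup>2 * (norm x)\<^sup>2 \<le> cmod (cinner (blinfun_apply (op_poly ?w N) x) x)"
          by (simp only: norm_of_real) simp
        also have "\<dots> \<le> norm (blinfun_apply (op_poly ?w N) x) * norm x"
          by (rule Cauchy_Schwarz_cinner)
        finally show ?thesis using False by (simp add: power2_eq_square del: op_poly_pCons)
      qed simp
      then show ?thesis
        using \<open>b \<noteq> 0\<close> by (intro step[OF quadratic(2), of "b\<^sup>2"]) simp_all
    qed
  qed
qed

text \<open>With \<open>c = \<parallel>p(N)\<parallel>\<close>, the operator \<open>p(N)\<^sup>2 - c\<^sup>2\<close> is not bounded below, so \<open>p\<^sup>2 - c\<^sup>2\<close> has a root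
  in the spectrum of \<open>N\<close>.\<close>

lemma norm_op_poly_attained:
  assumes N: "self_adjoint_op N" and nz: "op_poly p N \<noteq> 0"
    and "p * p \<noteq> [:(norm (op_poly p N))\<^sup>2:]"
  shows "\<exists>t\<in>real_spectrum N. \<bar>poly p t\<bar> = norm (op_poly p N)"
proof (rule ccontr)
  define M where "M = op_poly p N"
  define c where "c = norm M"
  define q where "q = p * p - [:c\<^sup>2:]"
  have "c > 0" using nz by (simp add: c_def M_def)
  have sa: "self_adjoint_op M" unfolding M_def by (rule self_adjoint_op_poly[OF N])
  assume none: "\<not> ?thesis"
  have "poly q t \<noteq> 0" if "t \<in> real_spectrum N" for t
  proof
    assume "poly q t = 0"
    then have "(poly p t)\<^sup>2 = c\<^sup>2" by (simp add: q_def power2_eq_square)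
    then have "\<bar>poly p t\<bar> = c" using \<open>c > 0\<close> by - (rule power2_eq_imp_eq, simp_all)
    with none that show False by (auto simp: c_def M_def)
  qed
  moreover have "q \<noteq> 0" using assms(3) by (simp add: q_def c_def M_def)
  ultimately obtain \<delta> where "\<delta> > 0"
    and \<delta>: "\<And>x. \<delta> * norm x \<le> norm (blinfun_apply (op_poly q N) x)"
    using op_poly_bounded_below[OF N] by blast
  \<comment> \<open>Expanding the squared norm of \<open>M (M x) - c\<^sup>2 *\<^sub>R x\<close> and
    using \<open>norm M = c\<close> turns the lower bound for \<open>q(N)\<close> into a strict
    improvement of \<open>norm (M x) \<le> c * norm x\<close>.\<close>
  have le: "\<delta>\<^sup>2 * (norm x)\<^sup>2 \<le> c\<^sup>2 * (c\<^sup>2 * (norm x)\<^sup>2 - (norm (blinfun_apply M x))\<^sup>2)" for x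
  proof -
    have q: "blinfun_apply (op_poly q N) x = blinfun_apply M (blinfun_apply M x) - c\<^sup>2 *\<^sub>R x"
      by (simp add: q_def M_def op_poly_diff op_poly_mult blinfun.diff_left blinfun.scaleR_left blinfun.add_left)
    have "(\<delta> * norm x)\<^sup>2 \<le> (norm (blinfun_apply (op_poly q N) x))\<^sup>2"
      using \<delta>[of x] \<open>\<delta> > 0\<close> by (intro power_mono) simp_all
    also have "\<dots> = (norm (blinfun_apply M (blinfun_apply M x)))\<^sup>2 + c\<^sup>2 * (c\<^sup>2 * (norm x)\<^sup>2)
        - 2 * (c\<^sup>2 * (norm (blinfun_apply M x))\<^sup>2)"
      unfolding q norm_diff_power2
      by (simp add: cinner_scaleR_right self_adjoint_square_norm[OF sa] power2_eq_square)
    also have "(norm (blinfun_apply M (blinfun_apply M x)))\<^sup>2 \<le> (c * norm (blinfun_apply M x))\<^sup>2"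
      unfolding c_def by (intro power_mono norm_blinfun) simp
    finally show ?thesis by (simp add: power_mult_distrib algebra_simps)
  qed
  have bound: "(norm (blinfun_apply M x))\<^sup>2 \<le> (c\<^sup>2 - \<delta>\<^sup>2 / c\<^sup>2) * (norm x)\<^sup>2" for x
    using le[of x] \<open>c > 0\<close> by (simp add: field_simps)
  obtain x where "blinfun_apply M x \<noteq> 0"
    using nz unfolding M_def by (metis blinfun_eqI blinfun.zero_left)
  then have "x \<noteq> 0" by (auto simp: blinfun.zero_right)
  have nonneg: "0 \<le> c\<^sup>2 - \<delta>\<^sup>2 / c\<^sup>2"
  proof -
    have "0 \<le> (c\<^sup>2 - \<delta>\<^sup>2 / c\<^sup>2) * (norm x)\<^sup>2"
      using bound[of x] by (rule order_trans[rotated]) simp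
    with \<open>x \<noteq> 0\<close> show ?thesis by (simp add: zero_le_mult_iff)
  qed
  have "norm M \<le> sqrt (c\<^sup>2 - \<delta>\<^sup>2 / c\<^sup>2)"
  proof (rule norm_blinfun_bound)
    show "norm (blinfun_apply M x) \<le> sqrt (c\<^sup>2 - \<delta>\<^sup>2 / c\<^sup>2) * norm x" for x
      by (rule power2_le_imp_le) (use bound[of x] nonneg in \<open>simp_all add: power_mult_distrib\<close>)
  qed (use nonneg in simp)
  then have "c\<^sup>2 \<le> (sqrt (c\<^sup>2 - \<delta>\<^sup>2 / c\<^sup>2))\<^sup>2"
    unfolding c_def[symmetric] using \<open>c > 0\<close> by (intro power_mono) simp_all
  with nonneg have "\<delta>\<^sup>2 / c\<^sup>2 \<le> 0" by simp
  moreover have "\<delta>\<^sup>2 / c\<^sup>2 > 0" using \<open>\<delta> > 0\<close> \<open>c > 0\<close> by simp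
  ultimately show False by linarith
qed

text \<open>For \<open>N \<noteq> 0\<close>, \<open>norm_op_poly_attained\<close> applies to the
  polynomial \<open>X\<close>, whose square is not constant; for \<open>N = 0\<close> the vector
  \<open>x\<close> is an eigenvector.\<close>

lemma real_spectrum_nonempty:
  assumes N: "self_adjoint_op N" and "(x :: 'h::complex_hilbert_space) \<noteq> 0"
  shows "real_spectrum (N :: 'h \<Rightarrow>\<^sub>L 'h) \<noteq> {}"
proof (cases "N = 0")
  case True
  then have "0 \<in> op_spectrum N" using assms(2) by (intro eigenvalue_in_op_spectrum[of _ x]) simp_all
  then show ?thesis by (metis empty_Collect_eq of_real_0)
next
  case False
  have N1: "op_poly [:0, 1:] N = N" by (rule blinfun_eqI) (simp add: blinfun.add_left)
  have "\<exists>t\<in>real_spectrum N. \<bar>poly [:0, 1:] t\<bar> = norm (op_poly [:0, 1:] N)"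
    by (rule norm_op_poly_attained[OF N]) (unfold N1, simp_all add: False)
  then show ?thesis by blast
qed

text \<open>The norm of \<open>p(N)\<close> is itself a value of \<open>\<bar>p\<bar>\<close> on the
  spectrum as soon as \<open>p(N)\<close> is nonzero.\<close>

lemma norm_op_poly_le:
  assumes N: "self_adjoint_op N" and "C \<ge> 0"
    and le: "\<And>t. t \<in> real_spectrum N \<Longrightarrow> \<bar>poly p t\<bar> \<le> C"
  shows "norm (op_poly p N) \<le> C"
proof (rule ccontr)
  let ?c = "norm (op_poly p N)"
  assume "\<not> ?thesis"
  then have gt: "?c > C" by simp
  with \<open>C \<ge> 0\<close> have nz: "op_poly p N \<noteq> 0" by auto
  have "\<exists>t\<in>real_spectrum N. \<bar>poly p t\<bar> = ?c"
  \<comment> \<open>In this exceptional case \<open>\<bar>p\<bar>\<close> is constant and every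
    point of the nonempty spectrum will do.\<close>
  proof (cases "p * p = [:?c\<^sup>2:]")
    case True
    obtain x where "blinfun_apply (op_poly p N) x \<noteq> 0"
      using nz by (metis blinfun_eqI blinfun.zero_left)
    then have "x \<noteq> 0" by (auto simp: blinfun.zero_right)
    then obtain t where "t \<in> real_spectrum N" using real_spectrum_nonempty[OF N] by blast
    moreover have "poly p t * poly p t = ?c\<^sup>2" using arg_cong[OF True, of "\<lambda>q. poly q t"] by simp
    then have "\<bar>poly p t\<bar> = ?c"
      by - (rule power2_eq_imp_eq, simp_all add: power2_eq_square)
    ultimately show ?thesis by blast
  qed (rule norm_op_poly_attained[OF N nz])
  with le gt show False by fastforce
qed

section \<open>Continuous functional calculus of a positive operator\<close>

context
  fixes N :: "'h::complex_hilbert_space \<Rightarrow>\<^sub>L 'h"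
  assumes N: "positive_op N"
begin

text \<open>Weierstrass approximation on \<open>{0..norm N}\<close>, which contains the
  spectrum.\<close>

lemma poly_approx_real_spectrum:
  assumes "continuous_on {0..} f"
  shows "\<exists>p. uniform_limit (real_spectrum N) (\<lambda>n. poly (p n)) f sequentially"
proof -
  have "\<exists>p. \<forall>t\<in>{0..norm N}. \<bar>f t - poly p t\<bar> < 1 / Suc n" for n
  proof -
    have "continuous_on {0..norm N} f" using assms by (rule continuous_on_subset) auto
    then obtain g where g: "real_polynomial_function g" "\<And>t. t \<in> {0..norm N} \<Longrightarrow> \<bar>f t - g t\<bar> < 1 / Suc n"
      using Stone_Weierstrass_real_polynomial_function[of "{0..norm N}" f "1 / Suc n"] by auto
    then obtain a m where g_eq: "g = (\<lambda>x. \<Sum>i\<le>m. a i * x ^ i)"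
      unfolding real_polynomial_function_iff_sum by blast
    have "poly (\<Sum>i\<le>m. monom (a i) i) = g"
      by (auto simp: g_eq poly_sum poly_monom)
    with g(2) show ?thesis by metis
  qed
  then obtain p where p: "\<And>n t. t \<in> {0..norm N} \<Longrightarrow> \<bar>f t - poly (p n) t\<bar> < 1 / Suc n" by metis
  have "uniform_limit (real_spectrum N) (\<lambda>n. poly (p n)) f sequentially"
  proof (rule uniform_limitI)
    fix e :: real assume "e > 0"
    then obtain M where M: "1 / real (Suc M) < e"
      using reals_Archimedean[of e] by (auto simp: inverse_eq_divide)
    have "dist (poly (p n) t) (f t) < e" if "n \<ge> M" "t \<in> real_spectrum N" for n t
    proof -
      have "1 / real (Suc n) \<le> 1 / real (Suc M)" using that by (simp add: frac_le)
      moreover have "t \<in> {0..norm N}" using that(2) real_spectrum_positive_op[OF N] by blast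
      ultimately show ?thesis using p[of t n] M by (simp add: dist_real_def abs_minus_commute)
    qed
    then show "\<forall>\<^sub>F n in sequentially. \<forall>t\<in>real_spectrum N. dist (poly (p n) t) (f t) < e"
      by (auto simp: eventually_sequentially)
  qed
  then show ?thesis by blast
qed

text \<open>\<open>norm_op_poly_le\<close> turns uniform closeness on the spectrum into closeness in
  norm. With \<open>q = p\<close> this gives the Cauchy property, with two sequences it shows that
  the limit does not depend on the choice.\<close>

lemma op_poly_uniform_diff:
  assumes "uniform_limit (real_spectrum N) (\<lambda>n. poly (p n)) f sequentially"
    and "uniform_limit (real_spectrum N) (\<lambda>n. poly (q n)) f sequentially" and "e > 0"
  shows "\<exists>M. \<forall>m\<ge>M. \<forall>n\<ge>M. norm (op_poly (p m) N - op_poly (q n) N) \<le> e"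
proof -
  obtain M1 where M1: "\<And>n t. n \<ge> M1 \<Longrightarrow> t \<in> real_spectrum N \<Longrightarrow> dist (poly (p n) t) (f t) < e / 2"
    using uniform_limitD[OF assms(1), of "e / 2"] \<open>e > 0\<close> by (auto simp: eventually_sequentially)
  obtain M2 where M2: "\<And>n t. n \<ge> M2 \<Longrightarrow> t \<in> real_spectrum N \<Longrightarrow> dist (poly (q n) t) (f t) < e / 2"
    using uniform_limitD[OF assms(2), of "e / 2"] \<open>e > 0\<close> by (auto simp: eventually_sequentially)
  have "norm (op_poly (p m) N - op_poly (q n) N) \<le> e" if "m \<ge> max M1 M2" "n \<ge> max M1 M2" for m n
    unfolding op_poly_diff[symmetric]
  proof (rule norm_op_poly_le[OF positive_opD(1)[OF N]])
    fix t assume "t \<in> real_spectrum N"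
    then have "dist (poly (p m) t) (f t) < e / 2" "dist (poly (q n) t) (f t) < e / 2"
      using M1 M2 that by auto
    then show "\<bar>poly (p m - q n) t\<bar> \<le> e" unfolding dist_real_def poly_diff by linarith
  qed (use \<open>e > 0\<close> in simp)
  then show ?thesis by blast
qed

text \<open>Justifies the definite description in \<open>op_cfc_def\<close>: one approximating
  sequence exists and is Cauchy, and every other one is asymptotically equal to it.\<close>

lemma op_cfc_tendsto:
  assumes f: "continuous_on {0..} f"
    and p: "uniform_limit (real_spectrum N) (\<lambda>n. poly (p n)) f sequentially"
  shows "(\<lambda>n. op_poly (p n) N) \<longlonglongrightarrow> op_cfc f N"
proof -
  obtain p0 where p0: "uniform_limit (real_spectrum N) (\<lambda>n. poly (p0 n)) f sequentially"
    using poly_approx_real_spectrum[OF f] by blast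
  have "Cauchy (\<lambda>n. op_poly (p0 n) N)"
  proof (rule metric_CauchyI)
    fix e :: real assume "e > 0"
    then obtain M where "\<forall>m\<ge>M. \<forall>n\<ge>M. norm (op_poly (p0 m) N - op_poly (p0 n) N) \<le> e / 2"
      using op_poly_uniform_diff[OF p0 p0, of "e / 2"] by auto
    then have "\<forall>m\<ge>M. \<forall>n\<ge>M. dist (op_poly (p0 m) N) (op_poly (p0 n) N) < e"
      using \<open>e > 0\<close> by (fastforce simp: dist_norm)
    then show "\<exists>M. \<forall>m\<ge>M. \<forall>n\<ge>M. dist (op_poly (p0 m) N) (op_poly (p0 n) N) < e" by blast
  qed
  then obtain B where B: "(\<lambda>n. op_poly (p0 n) N) \<longlonglongrightarrow> B"
    using Cauchy_convergent convergent_def by blast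
  have lim: "(\<lambda>n. op_poly (p n) N) \<longlonglongrightarrow> B"
    if p: "uniform_limit (real_spectrum N) (\<lambda>n. poly (p n)) f sequentially" for p
  proof -
    have "(\<lambda>n. op_poly (p n) N - op_poly (p0 n) N) \<longlonglongrightarrow> 0"
    proof (rule LIMSEQ_I)
      fix e :: real assume "e > 0"
      then obtain M where M: "\<forall>m\<ge>M. \<forall>n\<ge>M. norm (op_poly (p m) N - op_poly (p0 n) N) \<le> e / 2"
        using op_poly_uniform_diff[OF p p0, of "e / 2"] by auto
      have "norm (op_poly (p n) N - op_poly (p0 n) N - 0) < e" if "n \<ge> M" for n
      proof -
        have "norm (op_poly (p n) N - op_poly (p0 n) N) \<le> e / 2" using M that by blast
        with \<open>e > 0\<close> show ?thesis by simp
      qed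
      then show "\<exists>M. \<forall>n\<ge>M. norm (op_poly (p n) N - op_poly (p0 n) N - 0) < e" by blast
    qed
    from tendsto_add[OF this B] show ?thesis by simp
  qed
  have "op_cfc f N = B"
    unfolding op_cfc_def
  proof (rule the_equality)
    fix B' assume "\<forall>p. uniform_limit (real_spectrum N) (\<lambda>n. poly (p n)) f sequentially \<longrightarrow>
      (\<lambda>n. op_poly (p n) N) \<longlonglongrightarrow> B'"
    with p0 B show "B' = B" using LIMSEQ_unique by blast
  qed (use lim in blast)
  with lim[OF p] show ?thesis by simp
qed

text \<open>A constant sequence of polynomials. Agreement on the spectrum is enough, which makes
  rank one operators computable.\<close>

lemma op_cfc_eq_poly:
  assumes "continuous_on {0..} f" and "\<And>t. t \<in> real_spectrum N \<Longrightarrow> poly p t = f t"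
  shows "op_cfc f N = op_poly p N"
proof -
  have "uniform_limit (real_spectrum N) (\<lambda>n. poly p) f sequentially"
    by (rule uniform_limitI) (use assms(2) in simp)
  from op_cfc_tendsto[OF assms(1) this] show ?thesis
    by (simp add: LIMSEQ_const_iff)
qed

lemma self_adjoint_op_cfc:
  assumes "continuous_on {0..} f"
  shows "self_adjoint_op (op_cfc f N)"
proof -
  obtain p where "uniform_limit (real_spectrum N) (\<lambda>n. poly (p n)) f sequentially"
    using poly_approx_real_spectrum[OF assms] by blast
  then have lim: "(\<lambda>n. op_poly (p n) N) \<longlonglongrightarrow> op_cfc f N" by (rule op_cfc_tendsto[OF assms])
  have sa: "self_adjoint_op (op_poly (p n) N)" for n
    by (rule self_adjoint_op_poly[OF positive_opD(1)[OF N]])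
  have lim': "(\<lambda>n. blinfun_apply (op_poly (p n) N) x) \<longlonglongrightarrow> blinfun_apply (op_cfc f N) x" for x
    by (intro blinfun.tendsto lim tendsto_const)
  have "cinner (blinfun_apply (op_cfc f N) x) y = cinner x (blinfun_apply (op_cfc f N) y)" for x y
    using tendsto_cinner[OF lim'[of x] tendsto_const[of y]] tendsto_cinner[OF tendsto_const[of x] lim'[of y]]
    unfolding self_adjoint_opD(2)[OF sa] by (rule LIMSEQ_unique)
  moreover have "op_cfc f N \<in> bounded_ops"
    by (rule bounded_ops_tendsto[OF _ lim]) (rule self_adjoint_opD(1)[OF sa])
  ultimately show ?thesis by (simp add: self_adjoint_op_def)
qed

text \<open>Products of approximating polynomials approximate the product, since \<open>f\<close>
  and \<open>g\<close> are bounded on the compact interval containing the spectrum.\<close>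

lemma op_cfc_mult:
  assumes f: "continuous_on {0..} f" and g: "continuous_on {0..} g"
    and h: "continuous_on {0..} h" and eq: "\<And>t. t \<ge> 0 \<Longrightarrow> h t = f t * g t"
  shows "op_cfc h N = op_cfc f N o\<^sub>L op_cfc g N"
proof -
  obtain p where p: "uniform_limit (real_spectrum N) (\<lambda>n. poly (p n)) f sequentially"
    using poly_approx_real_spectrum[OF f] by blast
  obtain q where q: "uniform_limit (real_spectrum N) (\<lambda>n. poly (q n)) g sequentially"
    using poly_approx_real_spectrum[OF g] by blast
  have bdd: "bounded (k ` real_spectrum N)" if "continuous_on {0..} k" for k :: "real \<Rightarrow> real"
  proof (rule bounded_subset)
    show "bounded (k ` {0..norm N})"
      by (intro compact_imp_bounded compact_continuous_image continuous_on_subset[OF that]) auto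
    show "k ` real_spectrum N \<subseteq> k ` {0..norm N}"
      using real_spectrum_positive_op[OF N] by blast
  qed
  have "uniform_limit (real_spectrum N) (\<lambda>n t. poly (p n) t * poly (q n) t) (\<lambda>t. f t * g t) sequentially"
    by (rule uniform_lim_mult[OF p q bdd[OF f] bdd[OF g]])
  also have "?this \<longleftrightarrow> uniform_limit (real_spectrum N) (\<lambda>n. poly (p n * q n)) h sequentially"
    by (rule uniform_limit_cong') (use real_spectrum_positive_op[OF N] in \<open>auto simp: eq\<close>)
  finally have "(\<lambda>n. op_poly (p n * q n) N) \<longlonglongrightarrow> op_cfc h N" by (rule op_cfc_tendsto[OF h])
  moreover have "(\<lambda>n. op_poly (p n * q n) N) \<longlonglongrightarrow> (op_cfc f N o\<^sub>L op_cfc g N)"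
    unfolding op_poly_mult
    by (intro bounded_bilinear.tendsto[OF bounded_bilinear_blinfun_compose]
        op_cfc_tendsto f g p q)
  ultimately show ?thesis by (rule LIMSEQ_unique)
qed

text \<open>\<open>f(N)\<close> is the square of the self-adjoint operator obtained from the square
  root of \<open>f\<close>.\<close>

lemma positive_op_cfc:
  assumes f: "continuous_on {0..} f" and nonneg: "\<And>t. t \<ge> 0 \<Longrightarrow> f t \<ge> 0"
  shows "positive_op (op_cfc f N)"
proof -
  have cont: "continuous_on {0..} (\<lambda>t. sqrt (f t))" by (intro continuous_intros f)
  let ?S = "op_cfc (\<lambda>t. sqrt (f t)) N"
  have "op_cfc f N = ?S o\<^sub>L ?S" by (rule op_cfc_mult[OF cont cont f]) (simp add: nonneg)
  then have "0 \<le> Re (cinner (blinfun_apply (op_cfc f N) x) x)" for x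
    by (simp add: self_adjoint_square_norm[OF self_adjoint_op_cfc[OF cont]])
  then show ?thesis
    by (simp add: positive_op_def self_adjoint_op_cfc[OF f])
qed

end

section \<open>Absolute values and their powers\<close>

lemma continuous_on_powr_nonneg: "r > 0 \<Longrightarrow> continuous_on {0..} (\<lambda>t::real. t powr r)"
  by (intro continuous_on_powr' continuous_intros) auto

text \<open>\<langle>N (N w), w\<rangle> is the squared norm of \<open>N w\<close>, so
  \<open>N\<close> and its square have the same kernel; induction lowers the exponent one by
  one.\<close>

lemma self_adjoint_power_kernel:
  assumes N: "self_adjoint_op N" and "blinfun_apply (op_poly (monom 1 (Suc k)) N) x = 0"
  shows "blinfun_apply N x = 0"
  using assms(2)
proof (induction k)
  case 0
  then show ?case by (simp add: monom_Suc blinfun.add_left)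
next
  case (Suc k)
  define w where "w = blinfun_apply (op_poly (monom 1 k) N) x"
  have "blinfun_apply N (blinfun_apply N w) = 0"
    using Suc.prems by (simp add: monom_Suc w_def)
  then have "blinfun_apply N w = 0"
    using self_adjoint_square_norm[OF N, of w] by simp
  then show ?case using Suc.IH by (simp add: monom_Suc w_def)
qed

lemma positive_op_adjoint_compose:
  assumes A: "A \<in> bounded_ops"
  shows "positive_op (op_adjoint A o\<^sub>L A)"
proof -
  have left: "cinner (blinfun_apply (op_adjoint A) y) x = cinner y (blinfun_apply A x)" for x y
    by (metis cinner_op_adjoint[OF A] cinner_commute)
  show ?thesis
    by (simp add: positive_op_def self_adjoint_op_def bounded_ops_compose A left
        cinner_op_adjoint[OF A, symmetric] power2_norm_eq_cinner[symmetric])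
qed

lemma positive_op_abs:
  assumes "A \<in> bounded_ops"
  shows "positive_op (op_abs A)"
  unfolding op_abs_def
  by (intro positive_op_cfc positive_op_adjoint_compose assms continuous_intros) simp

text \<open>The square of \<open>op_abs A\<close> is \<open>op_adjoint A o\<^sub>L A\<close>, whose
  quadratic form is the squared norm of \<open>A x\<close>.\<close>

lemma op_abs_kernel:
  assumes A: "A \<in> bounded_ops" and "blinfun_apply (op_abs A) x = 0"
  shows "blinfun_apply A x = 0"
proof -
  let ?N = "op_adjoint A o\<^sub>L A"
  have N: "positive_op ?N" by (rule positive_op_adjoint_compose[OF A])
  have id: "continuous_on {0..} (\<lambda>t::real. t)" by (rule continuous_on_id)
  have sqrt: "continuous_on {0..} sqrt" by (intro continuous_intros)
  have "op_cfc (\<lambda>t. t) ?N = op_poly [:0, 1:] ?N"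
    by (rule op_cfc_eq_poly[OF N id]) simp
  moreover have "op_cfc (\<lambda>t. t) ?N = op_abs A o\<^sub>L op_abs A"
    unfolding op_abs_def by (rule op_cfc_mult[OF N sqrt sqrt id]) simp
  ultimately have "op_abs A o\<^sub>L op_abs A = ?N" by (intro blinfun_eqI) (simp add: blinfun.add_left)
  then have "blinfun_apply ?N x = 0"
    using assms(2) by (metis blinfun_apply_blinfun_compose blinfun.zero_right)
  then have "cinner (blinfun_apply A x) (blinfun_apply A x) = 0"
    by (simp add: cinner_op_adjoint[OF A])
  then show ?thesis by simp
qed

lemma self_adjoint_op_abs_powr:
  assumes "A \<in> bounded_ops" and "r > 0"
  shows "self_adjoint_op (op_abs_powr A r)"
  unfolding op_abs_powr_def
  by (intro self_adjoint_op_cfc positive_op_abs continuous_on_powr_nonneg assms)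

text \<open>A further power completes the exponent \<open>r + s\<close> to a positive integer, where
  \<open>self_adjoint_power_kernel\<close> applies.\<close>

lemma op_abs_powr_kernel:
  assumes A: "A \<in> bounded_ops" and "r > 0" "s > 0"
    and zero: "blinfun_apply (op_abs_powr A s) (blinfun_apply (op_abs_powr A r) x) = 0"
  shows "blinfun_apply A x = 0"
proof -
  let ?N = "op_abs A"
  have N: "positive_op ?N" by (rule positive_op_abs[OF A])
  \<comment> \<open>The complementary exponent must be positive, so that its power function is
    continuous at 0.\<close>
  obtain k :: nat where "real k > r + s" using reals_Archimedean2 by blast
  then have u: "real (Suc k) - (r + s) > 0" by simp
  have monom: "continuous_on {0..} (\<lambda>t::real. t ^ Suc k)" by (intro continuous_intros)
  have "op_cfc (\<lambda>t. t ^ Suc k) ?N =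
      op_cfc (\<lambda>t. t powr (real (Suc k) - (r + s))) ?N o\<^sub>L op_cfc (\<lambda>t. t powr (s + r)) ?N"
  proof (rule op_cfc_mult[OF N _ _ monom])
    show "t ^ Suc k = t powr (real (Suc k) - (r + s)) * t powr (s + r)" if "0 \<le> t" for t :: real
      using powr_realpow'[OF that, of "Suc k"]
      by (simp add: powr_add[symmetric] del: power_Suc)
    show "continuous_on {0..} (\<lambda>t::real. t powr (s + r))"
      by (rule continuous_on_powr_nonneg) (use assms in simp)
  qed (rule continuous_on_powr_nonneg[OF u])
  also have "op_cfc (\<lambda>t. t powr (s + r)) ?N = op_abs_powr A s o\<^sub>L op_abs_powr A r"
    unfolding op_abs_powr_def using assms
    by (intro op_cfc_mult[OF N] continuous_on_powr_nonneg) (simp_all add: powr_add)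
  also have "op_cfc (\<lambda>t. t ^ Suc k) ?N = op_poly (monom 1 (Suc k)) ?N"
    by (rule op_cfc_eq_poly[OF N monom]) (simp add: poly_monom)
  finally have "blinfun_apply (op_poly (monom 1 (Suc k)) ?N) x = 0"
    by (simp add: zero blinfun.zero_right)
  then have "blinfun_apply ?N x = 0"
    by (rule self_adjoint_power_kernel[OF positive_opD(1)[OF N]])
  then show ?thesis by (rule op_abs_kernel[OF A])
qed

section \<open>Rank one operators\<close>

definition rank_one :: "'h::complex_hilbert_space \<Rightarrow> 'h \<Rightarrow> ('h \<Rightarrow>\<^sub>L 'h)" where
  "rank_one x y = Blinfun (\<lambda>z. cinner z y *\<^sub>C x)"

lemma rank_one_aux:
  fixes x y :: "'h::complex_hilbert_space"
  shows "rank_one x y \<in> bounded_ops \<and> blinfun_apply (rank_one x y) = (\<lambda>z. cinner z y *\<^sub>C x)"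
proof -
  have "norm (cinner z y *\<^sub>C x) \<le> (norm x * norm y) * norm z" for z
    using mult_right_mono[OF Cauchy_Schwarz_cinner[of z y], of "norm x"] by (simp add: mult_ac)
  then obtain F where F: "F \<in> bounded_ops" "blinfun_apply F = (\<lambda>z. cinner z y *\<^sub>C x)"
    by (rule bounded_opsE[of "\<lambda>z. cinner z y *\<^sub>C x", rotated 2])
      (simp_all add: cinner_simps scaleC_add_left scaleC_scaleC)
  then have "rank_one x y = F"
    unfolding rank_one_def by (metis blinfun_apply_inverse)
  with F show ?thesis by simp
qed

lemma rank_one_apply [simp]: "blinfun_apply (rank_one x y) z = cinner z y *\<^sub>C x"
  and rank_one_in [simp]: "rank_one x y \<in> bounded_ops"
  using rank_one_aux by (simp_all add: rank_one_aux)

lemma rank_one_zero_left [simp]: "rank_one 0 y = 0"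
  by (rule blinfun_eqI) simp

lemma scaleR_rank_one: "a *\<^sub>R rank_one x y = rank_one (a *\<^sub>R x) y"
  by (rule blinfun_eqI) (simp add: blinfun.scaleR_left scaleR_eq_scaleC scaleC_scaleC mult.commute)

lemma rank_one_scaleC_right: "rank_one x (c *\<^sub>C y) = rank_one (cnj c *\<^sub>C x) y"
  by (rule blinfun_eqI) (simp add: cinner_simps scaleC_scaleC mult.commute)

lemma rank_one_inject_left: "rank_one x y = rank_one x' y \<Longrightarrow> y \<noteq> 0 \<Longrightarrow> x = x'"
proof -
  assume eq: "rank_one x y = rank_one x' y" and "y \<noteq> 0"
  have "cinner y y *\<^sub>C x = cinner y y *\<^sub>C x'"
    using arg_cong[OF eq, of "\<lambda>A. blinfun_apply A y"] by simp
  with \<open>y \<noteq> 0\<close> show ?thesis by (simp add: scaleC.scale_cancel_left)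
qed

lemma scaleC_op_exists: "\<exists>S\<in>bounded_ops. \<forall>x :: 'h::complex_hilbert_space. blinfun_apply S x = c *\<^sub>C x"
proof -
  obtain S where "S \<in> bounded_ops" "blinfun_apply S = (\<lambda>x :: 'h. c *\<^sub>C x)"
    by (rule bounded_opsE[of "\<lambda>x. c *\<^sub>C x" "cmod c"]) (simp_all add: scaleC_add_right scaleC_scaleC mult.commute)
  then show ?thesis by (intro bexI[of _ S]) simp_all
qed

text \<open>A nonzero vector orthogonal to \<open>v\<close> puts \<open>0\<close> into the spectrum; this fails in dimension one.\<close>

lemma op_spectrum_rank_one:
  fixes u v :: "'h::complex_hilbert_space"
  assumes "z \<noteq> 0" and "cinner z v = 0"
  shows "op_spectrum (rank_one u v) = {0, cinner u v}"
proof -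
  let ?\<tau> = "cinner u v"
  have zero: "0 \<in> op_spectrum (rank_one u v)"
    using assms by (intro eigenvalue_in_op_spectrum[of _ z]) simp_all
  moreover have "?\<tau> \<in> op_spectrum (rank_one u v)"
  proof (cases "u = 0")
    case False
    then show ?thesis by (intro eigenvalue_in_op_spectrum[of _ u]) simp_all
  qed (use zero in simp)
  moreover have "c \<notin> op_spectrum (rank_one u v)" if "c \<noteq> 0" "c \<noteq> ?\<tau>" for c
  proof -
    \<comment> \<open>Sherman-Morrison formula: the inverse of \<open>rank_one u v - c\<close> is
      \<open>- 1 / c\<close> plus a multiple of \<open>rank_one u v\<close>.\<close>
    obtain S :: "'h \<Rightarrow>\<^sub>L 'h"
      where S: "S \<in> bounded_ops" "\<And>x. blinfun_apply S x = (- 1 / c) *\<^sub>C x"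
      using scaleC_op_exists[of "- 1 / c"] by metis
    have B_apply: "blinfun_apply (S + rank_one ((- 1 / (c * (c - ?\<tau>))) *\<^sub>C u) v) x =
        (- 1 / c) *\<^sub>C x + (cinner x v * (- 1 / (c * (c - ?\<tau>)))) *\<^sub>C u" for x
      by (simp add: blinfun.add_left S scaleC_scaleC)
    have 1: "(- 1 / c) *\<^sub>C (cinner x v *\<^sub>C u - c *\<^sub>C x) = x + (- cinner x v / c) *\<^sub>C u" for x
      using that by (simp add: scaleC.scale_right_diff_distrib scaleC_scaleC)
    have 2: "cinner (cinner x v *\<^sub>C u - c *\<^sub>C x) v * (- 1 / (c * (c - ?\<tau>))) = cinner x v / c" for x
      using that by (simp add: cinner_simps divide_simps) (simp add: algebra_simps)
    have 3: "cinner ((- 1 / c) *\<^sub>C x + (cinner x v * (- 1 / (c * (c - ?\<tau>)))) *\<^sub>C u) v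
        - c * (cinner x v * (- 1 / (c * (c - ?\<tau>)))) = 0" for x
      using that by (simp add: cinner_simps divide_simps) (simp add: algebra_simps)
    show ?thesis
    proof (rule not_in_op_spectrumI[of "S + rank_one ((- 1 / (c * (c - ?\<tau>))) *\<^sub>C u) v"])
      show "S + rank_one ((- 1 / (c * (c - ?\<tau>))) *\<^sub>C u) v \<in> bounded_ops"
        by (intro bounded_ops_add S rank_one_in)
      show "blinfun_apply (S + rank_one ((- 1 / (c * (c - ?\<tau>))) *\<^sub>C u) v)
          (blinfun_apply (rank_one u v) x - c *\<^sub>C x) = x" for x
        unfolding B_apply rank_one_apply 1 2 by (simp add: add.assoc scaleC_add_left[symmetric])
      show "blinfun_apply (rank_one u v)
          (blinfun_apply (S + rank_one ((- 1 / (c * (c - ?\<tau>))) *\<^sub>C u) v) x)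
          - c *\<^sub>C blinfun_apply (S + rank_one ((- 1 / (c * (c - ?\<tau>))) *\<^sub>C u) v) x = x" for x
      proof -
        let ?b = "cinner x v * (- 1 / (c * (c - ?\<tau>)))"
        have expand: "\<alpha> *\<^sub>C u - c *\<^sub>C ((- 1 / c) *\<^sub>C x + b *\<^sub>C u) = x + (\<alpha> - c * b) *\<^sub>C u" for \<alpha> b
          using that by (simp add: scaleC_add_right scaleC_scaleC scaleC.scale_left_diff_distrib
              scaleC.scale_right_diff_distrib)
        show ?thesis unfolding B_apply rank_one_apply expand 3 by simp
      qed
    qed
  qed
  ultimately show ?thesis by blast
qed

section \<open>Functional calculus of rank one operators\<close>

lemma op_adjoint_rank_one [simp]: "op_adjoint (rank_one x y) = rank_one y x"
proof (rule op_adjoint_eqI)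
  show "cinner (blinfun_apply (rank_one x y) z) w = cinner z (blinfun_apply (rank_one y x) w)" for z w
    by (simp add: cinner_simps cinner_commute[of x w])
qed

text \<open>The operator is \<open>k * (norm y)\<^sup>2\<close> times the projection onto the line
  of \<open>y\<close>. Its spectrum consists of 0 and this number, so \<open>f\<close> with
  \<open>f 0 = 0\<close> may be replaced by a multiple of \<open>X\<close>.\<close>

lemma op_cfc_rank_one:
  assumes f: "continuous_on {0..} f" "f 0 = 0" and "k > 0" "y \<noteq> 0"
    and z: "z \<noteq> 0" "cinner z y = 0"
  shows "op_cfc f (rank_one (k *\<^sub>R y) y) = rank_one ((f (k * (norm y)\<^sup>2) / (norm y)\<^sup>2) *\<^sub>R y) y"
proof -
  let ?N = "rank_one (k *\<^sub>R y) y"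
  let ?\<kappa> = "k * (norm y)\<^sup>2"
  have "Re (cinner z y * cinner y z) \<ge> 0" for z by (simp add: cinner_mult_commute)
  then have N: "positive_op ?N"
    using \<open>k > 0\<close> by (simp add: positive_op_def self_adjoint_op_def cinner_simps
        cinner_commute[of y] mult.left_commute)
  have spec: "t = 0 \<or> t = ?\<kappa>" if "t \<in> real_spectrum ?N" for t
  proof -
    have "complex_of_real t = 0 \<or> complex_of_real t = complex_of_real ?\<kappa>"
      using that op_spectrum_rank_one[OF z, of "k *\<^sub>R y"]
      by (simp add: cinner_simps cinner_self)
    then show ?thesis using of_real_eq_iff[of t ?\<kappa>] of_real_eq_0_iff[of t] by blast
  qed
  have "op_cfc f ?N = op_poly [:0, f ?\<kappa> / ?\<kappa>:] ?N"
    using assms spec by (intro op_cfc_eq_poly[OF N f(1)]) fastforce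
  also have "\<dots> = (f ?\<kappa> / ?\<kappa>) *\<^sub>R ?N"
    by (rule blinfun_eqI) (simp add: blinfun.add_left blinfun.scaleR_left blinfun.scaleR_right
        del: rank_one_apply)
  also have "\<dots> = rank_one ((f ?\<kappa> / (norm y)\<^sup>2) *\<^sub>R y) y"
    unfolding scaleR_rank_one using \<open>k > 0\<close> by simp
  finally show ?thesis .
qed

text \<open>The absolute value of \<open>rank_one x y\<close> is \<open>norm x * norm y\<close>
  times the projection onto the line of \<open>y\<close>.\<close>

lemma op_abs_powr_rank_one:
  assumes "x \<noteq> 0" "y \<noteq> 0" "r > 0" and z: "z \<noteq> 0" "cinner z y = 0"
  shows "op_abs_powr (rank_one x y) r =
    rank_one (((norm x * norm y) powr r / (norm y)\<^sup>2) *\<^sub>R y) y"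
proof -
  have "op_adjoint (rank_one x y) o\<^sub>L rank_one x y = rank_one ((norm x)\<^sup>2 *\<^sub>R y) y"
    by (rule blinfun_eqI)
      (simp add: cinner_simps cinner_self scaleR_eq_scaleC scaleC_scaleC mult.commute)
  then have "op_abs (rank_one x y) = op_cfc sqrt (rank_one ((norm x)\<^sup>2 *\<^sub>R y) y)"
    by (simp add: op_abs_def)
  also have "\<dots> = rank_one ((sqrt ((norm x)\<^sup>2 * (norm y)\<^sup>2) / (norm y)\<^sup>2) *\<^sub>R y) y"
    using assms by (intro op_cfc_rank_one[OF _ _ _ _ z] continuous_intros) simp_all
  also have "sqrt ((norm x)\<^sup>2 * (norm y)\<^sup>2) / (norm y)\<^sup>2 = norm x / norm y"
    using assms by (simp add: real_sqrt_mult power2_eq_square)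
  finally have "op_abs_powr (rank_one x y) r =
      rank_one (((norm x / norm y * (norm y)\<^sup>2) powr r / (norm y)\<^sup>2) *\<^sub>R y) y"
    unfolding op_abs_powr_def using assms
    by (simp only:) (intro op_cfc_rank_one[OF _ _ _ _ z] continuous_on_powr_nonneg, simp_all)
  also have "norm x / norm y * (norm y)\<^sup>2 = norm x * norm y"
    using assms by (simp add: power2_eq_square)
  finally show ?thesis .
qed

text \<open>The positive factor multiplying \<langle>B y, y\<rangle> in the spectrum of the sandwich
  product for \<open>rank_one x y\<close>, with \<open>t\<close> the sum of the two
  exponents.\<close>

definition weight :: "real \<Rightarrow> 'h::complex_hilbert_space \<Rightarrow> 'h \<Rightarrow> real" where
  "weight t x y = (norm x * norm y) powr t / (norm y)\<^sup>2"

lemma weight_pos: "x \<noteq> 0 \<Longrightarrow> y \<noteq> 0 \<Longrightarrow> weight t x y > 0"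
  by (simp add: weight_def)

text \<open>Both outer factors are multiples of \<open>rank_one y y\<close>, hence so is the whole
  product.\<close>

lemma op_spectrum_rank_one_sandwich:
  assumes "x \<noteq> 0" "y \<noteq> 0" "r > 0" "s > 0" and z: "z \<noteq> 0" "cinner z y = 0"
    and B: "B \<in> bounded_ops"
  shows "op_spectrum (op_abs_powr (rank_one x y) r o\<^sub>L B o\<^sub>L op_abs_powr (rank_one x y) s) =
    {0, of_real (weight (r + s) x y) * cinner (blinfun_apply B y) y}"
proof -
  define a where "a = (norm x * norm y) powr r / (norm y)\<^sup>2"
  define b where "b = (norm x * norm y) powr s / (norm y)\<^sup>2"
  let ?u = "(of_real (a * b) * cinner (blinfun_apply B y) y) *\<^sub>C y"
  have "op_abs_powr (rank_one x y) r o\<^sub>L B o\<^sub>L op_abs_powr (rank_one x y) s = rank_one ?u y"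
    unfolding op_abs_powr_rank_one[OF assms(1-3) z] op_abs_powr_rank_one[OF assms(1,2,4) z]
      a_def[symmetric] b_def[symmetric]
    by (rule blinfun_eqI)
      (simp add: scaleR_eq_scaleC scaleC_scaleC bounded_ops_scaleC[OF B] cinner_simps mult_ac)
  then have "op_spectrum (op_abs_powr (rank_one x y) r o\<^sub>L B o\<^sub>L op_abs_powr (rank_one x y) s) =
      {0, cinner ?u y}"
    by (simp only: op_spectrum_rank_one[OF z])
  also have "cinner ?u y = of_real (a * b * (norm y)\<^sup>2) * cinner (blinfun_apply B y) y"
    by (simp add: cinner_simps cinner_self)
  also have "a * b * (norm y)\<^sup>2 = weight (r + s) x y"
    using assms by (simp add: a_def b_def weight_def powr_add power2_eq_square)
  finally show ?thesis .
qed

lemma op_abs_powr_zero: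
  assumes "r > 0"
  shows "op_abs_powr (0 :: 'h::complex_hilbert_space \<Rightarrow>\<^sub>L 'h) r = 0"
proof -
  have pos: "positive_op (0 :: 'h \<Rightarrow>\<^sub>L 'h)" by (simp add: positive_op_def self_adjoint_op_def)
  have cfc: "op_cfc f (0 :: 'h \<Rightarrow>\<^sub>L 'h) = 0" if "continuous_on {0..} f" "f 0 = 0" for f
    using op_cfc_eq_poly[OF pos that(1), of 0] real_spectrum_positive_op[OF pos] that(2) by fastforce
  have "continuous_on {0..} sqrt" by (intro continuous_intros)
  then have "op_abs (0 :: 'h \<Rightarrow>\<^sub>L 'h) = 0" by (simp add: op_abs_def cfc)
  then show ?thesis by (simp add: op_abs_powr_def cfc continuous_on_powr_nonneg assms)
qed

text \<open>If \<open>S R\<close> has two independent values \<open>S R x\<close>, \<open>S R y\<close>, then a rank two operator built from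
  a dual basis produces two prescribed eigenvalues with eigenvectors \<open>R x\<close>, \<open>R y\<close>.\<close>

lemma values_dependent:
  assumes R: "R \<in> bounded_ops" and S: "self_adjoint_op S"
    and one: "\<And>B c d. B \<in> bounded_ops \<Longrightarrow> c \<in> op_spectrum (R o\<^sub>L B o\<^sub>L S) \<Longrightarrow>
       d \<in> op_spectrum (R o\<^sub>L B o\<^sub>L S) \<Longrightarrow> c \<noteq> 0 \<Longrightarrow> d \<noteq> 0 \<Longrightarrow> c = d"
  shows "\<exists>a b. (a \<noteq> 0 \<or> b \<noteq> 0) \<and>
    blinfun_apply S (blinfun_apply R (a *\<^sub>C x + b *\<^sub>C y)) = 0"
proof (rule ccontr)
  assume "\<not> ?thesis"
  then have indep: "a = 0 \<and> b = 0"
    if "blinfun_apply S (blinfun_apply R (a *\<^sub>C x + b *\<^sub>C y)) = 0" for a b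
    using that by blast
  define p where "p = blinfun_apply S (blinfun_apply R x)"
  define q where "q = blinfun_apply S (blinfun_apply R y)"
  have lin: "a *\<^sub>C p + b *\<^sub>C q = 0 \<Longrightarrow> a = 0 \<and> b = 0" for a b
    using indep[of a b]
    by (simp add: blinfun.add_right bounded_ops_scaleC[OF R] bounded_ops_scaleC[OF self_adjoint_opD(1)[OF S]] p_def q_def)
  \<comment> \<open>Up to scaling, \<open>u\<close> and \<open>v\<close> form the dual basis of
    \<open>p\<close>, \<open>q\<close>: \<open>u\<close> is orthogonal to \<open>q\<close>, and
    \<open>v\<close> to \<open>p\<close>.\<close>
  define u where "u = cinner q q *\<^sub>C p - cinner p q *\<^sub>C q"
  define v where "v = cinner p p *\<^sub>C q - cinner q p *\<^sub>C p"
  have "p \<noteq> 0" using lin[of 1 0] by auto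
  have "q \<noteq> 0" using lin[of 0 1] by auto
  have "u \<noteq> 0" using lin[of "cinner q q" "- cinner p q"] \<open>q \<noteq> 0\<close> by (auto simp: u_def)
  have "v \<noteq> 0" using lin[of "- cinner q p" "cinner p p"] \<open>p \<noteq> 0\<close> by (auto simp: v_def)
  have uq: "cinner q u = 0" and vp: "cinner p v = 0"
    by (simp_all add: u_def v_def cinner_simps cinner_commute[of q p] cinner_self)
  have "cinner u u = cinner q q * cinner p u"
    by (subst (1) u_def) (simp add: cinner_simps uq)
  with \<open>u \<noteq> 0\<close> have up: "cinner p u \<noteq> 0" by auto
  have "cinner v v = cinner p p * cinner q v"
    by (subst (1) v_def) (simp add: cinner_simps vp)
  with \<open>v \<noteq> 0\<close> have vq: "cinner q v \<noteq> 0" by auto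
  \<comment> \<open>The coefficients are chosen so that \<open>B\<close> sends \<open>p\<close> to
    \<open>x\<close> and \<open>q\<close> to \<open>2 *\<^sub>C y\<close>.\<close>
  define B where "B = rank_one ((1 / cinner p u) *\<^sub>C x) u + rank_one ((2 / cinner q v) *\<^sub>C y) v"
  have B: "B \<in> bounded_ops" unfolding B_def by (intro bounded_ops_add rank_one_in)
  have "blinfun_apply (R o\<^sub>L B o\<^sub>L S) (blinfun_apply R x) = 1 *\<^sub>C blinfun_apply R x"
    using up by (simp add: p_def[symmetric] B_def blinfun.add_left vp scaleC_scaleC)
  moreover have "blinfun_apply R x \<noteq> 0" using \<open>p \<noteq> 0\<close> by (auto simp: p_def blinfun.zero_right)
  ultimately have "1 \<in> op_spectrum (R o\<^sub>L B o\<^sub>L S)" by (rule eigenvalue_in_op_spectrum)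
  moreover have "blinfun_apply (R o\<^sub>L B o\<^sub>L S) (blinfun_apply R y) = 2 *\<^sub>C blinfun_apply R y"
    using vq by (simp add: q_def[symmetric] B_def blinfun.add_left uq scaleC_scaleC bounded_ops_scaleC[OF R])
  moreover have "blinfun_apply R y \<noteq> 0" using \<open>q \<noteq> 0\<close> by (auto simp: q_def blinfun.zero_right)
  ultimately have "(1::complex) = 2"
    using one[OF B, of 1 2] eigenvalue_in_op_spectrum by fastforce
  then show False by simp
qed

section \<open>Recognising rank one operators by spectra\<close>

definition is_rank_one :: "('h::complex_hilbert_space \<Rightarrow>\<^sub>L 'h) \<Rightarrow> bool" where
  "is_rank_one A \<longleftrightarrow> (\<exists>x y. x \<noteq> 0 \<and> y \<noteq> 0 \<and> A = rank_one x y)"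

text \<open>Any two values of \<open>A\<close> are dependent, so all of them are multiples of one
  value \<open>p\<close>.\<close>

lemma is_rank_oneI:
  assumes A: "A \<in> bounded_ops" and "A \<noteq> 0"
    and dep: "\<And>x y. \<exists>a b. (a \<noteq> 0 \<or> b \<noteq> 0) \<and> blinfun_apply A (a *\<^sub>C x + b *\<^sub>C y) = 0"
  shows "is_rank_one A"
proof -
  obtain x where x: "blinfun_apply A x \<noteq> 0"
    using \<open>A \<noteq> 0\<close> by (metis blinfun_eqI blinfun.zero_left)
  define p where "p = blinfun_apply A x"
  \<comment> \<open>\<open>g\<close> represents the coefficient functional, sending \<open>y\<close>
    to \<langle>A y, p\<rangle> / \<langle>p, p\<rangle>.\<close>
  define g where "g = (1 / cinner p p) *\<^sub>C blinfun_apply (op_adjoint A) p"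
  have "cinner p p \<noteq> 0" using x by (simp add: p_def)
  have "blinfun_apply A y = cinner y g *\<^sub>C p" for y
  proof -
    obtain a b where ab: "a \<noteq> 0 \<or> b \<noteq> 0" "a *\<^sub>C p + b *\<^sub>C blinfun_apply A y = 0"
      using dep[of x y] by (auto simp: blinfun.add_right bounded_ops_scaleC[OF A] p_def)
    have "b \<noteq> 0" using ab x by (auto simp: p_def)
    have "blinfun_apply A y = (- a / b) *\<^sub>C p"
    proof -
      have "(1 / b) *\<^sub>C (a *\<^sub>C p + b *\<^sub>C blinfun_apply A y) = 0" using ab(2) by simp
      then show ?thesis using \<open>b \<noteq> 0\<close>
        by (simp add: scaleC_add_right scaleC_scaleC add_eq_0_iff)
    qed
    moreover have "cinner y g = cinner (blinfun_apply A y) p / cinner p p"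
      by (simp add: g_def cinner_simps cinner_op_adjoint[OF A] cinner_self)
    ultimately show ?thesis using \<open>cinner p p \<noteq> 0\<close> by (simp add: cinner_simps)
  qed
  then have eq: "A = rank_one p g" by (intro blinfun_eqI) simp
  moreover have "p \<noteq> 0" using x by (simp add: p_def)
  moreover have "g \<noteq> 0" using eq x by (metis rank_one_apply cinner_zero_right scaleC.scale_zero_left)
  ultimately show ?thesis unfolding is_rank_one_def by blast
qed

text \<open>The criterion mentions only spectra, so the map \<open>\<phi>\<close> of the theorem
  transports it. The second clause excludes \<open>A = 0\<close>; the first yields dependent values
  of the product of powers, and \<open>op_abs_powr_kernel\<close> passes this on to
  \<open>A\<close>.\<close>

lemma is_rank_one_iff_op_spectrum:
  fixes A :: "'h::complex_hilbert_space \<Rightarrow>\<^sub>L 'h"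
  assumes A: "A \<in> bounded_ops" and rs: "r > 0" "s > 0"
    and orth: "\<And>v :: 'h. \<exists>z. z \<noteq> 0 \<and> cinner z v = 0"
  defines "\<Sigma> \<equiv> \<lambda>B. op_spectrum (op_abs_powr A r o\<^sub>L B o\<^sub>L op_abs_powr A s)"
  shows "is_rank_one A \<longleftrightarrow>
    (\<forall>B\<in>bounded_ops. \<forall>c\<in>\<Sigma> B. \<forall>d\<in>\<Sigma> B. c \<noteq> 0 \<longrightarrow> d \<noteq> 0 \<longrightarrow> c = d) \<and>
    (\<exists>B\<in>bounded_ops. \<exists>c\<in>\<Sigma> B. c \<noteq> 0)"
proof
  assume "is_rank_one A"
  then obtain x y where xy: "x \<noteq> 0" "y \<noteq> 0" "A = rank_one x y" unfolding is_rank_one_def by blast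
  obtain z where z: "z \<noteq> 0" "cinner z y = 0" using orth by blast
  have \<Sigma>: "\<Sigma> B = {0, of_real (weight (r + s) x y) * cinner (blinfun_apply B y) y}"
    if "B \<in> bounded_ops" for B
    unfolding \<Sigma>_def xy(3) by (rule op_spectrum_rank_one_sandwich[OF xy(1,2) rs z that])
  have "of_real (weight (r + s) x y) * cinner (blinfun_apply id_blinfun y) y \<noteq> 0"
    using xy weight_pos[of x y "r + s"] by simp
  with \<Sigma>[OF bounded_ops_id] have "\<exists>B\<in>bounded_ops. \<exists>c\<in>\<Sigma> B. c \<noteq> 0"
    by (intro bexI[of _ id_blinfun]) auto
  then show "(\<forall>B\<in>bounded_ops. \<forall>c\<in>\<Sigma> B. \<forall>d\<in>\<Sigma> B. c \<noteq> 0 \<longrightarrow> d \<noteq> 0 \<longrightarrow> c = d) \<and>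
    (\<exists>B\<in>bounded_ops. \<exists>c\<in>\<Sigma> B. c \<noteq> 0)"
    using \<Sigma> by auto
next
  assume *: "(\<forall>B\<in>bounded_ops. \<forall>c\<in>\<Sigma> B. \<forall>d\<in>\<Sigma> B. c \<noteq> 0 \<longrightarrow> d \<noteq> 0 \<longrightarrow> c = d) \<and>
    (\<exists>B\<in>bounded_ops. \<exists>c\<in>\<Sigma> B. c \<noteq> 0)"
  have "A \<noteq> 0"
  proof
    assume "A = 0"
    then have "\<Sigma> B = op_spectrum (0 :: 'h \<Rightarrow>\<^sub>L 'h)" for B by (simp add: \<Sigma>_def op_abs_powr_zero rs)
    moreover have "op_spectrum (0 :: 'h \<Rightarrow>\<^sub>L 'h) = {0}"
      using op_spectrum_rank_one[of _ 0 0] orth[of 0] by (metis cinner_zero_left insert_absorb2 rank_one_zero_left)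
    ultimately show False using * by auto
  qed
  then show "is_rank_one A"
  proof (rule is_rank_oneI[OF A])
    fix x y
    have "\<exists>a b. (a \<noteq> 0 \<or> b \<noteq> 0) \<and>
        blinfun_apply (op_abs_powr A s) (blinfun_apply (op_abs_powr A r) (a *\<^sub>C x + b *\<^sub>C y)) = 0"
    proof (rule values_dependent)
      show "op_abs_powr A r \<in> bounded_ops" "self_adjoint_op (op_abs_powr A s)"
        using self_adjoint_op_abs_powr[OF A] rs self_adjoint_opD(1) by blast+
      show "c = d" if "B \<in> bounded_ops" "c \<noteq> 0" "d \<noteq> 0"
        "c \<in> op_spectrum (op_abs_powr A r o\<^sub>L B o\<^sub>L op_abs_powr A s)"
        "d \<in> op_spectrum (op_abs_powr A r o\<^sub>L B o\<^sub>L op_abs_powr A s)" for B c d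
        using conjunct1[OF *] that unfolding \<Sigma>_def by blast
    qed
    then show "\<exists>a b. (a \<noteq> 0 \<or> b \<noteq> 0) \<and> blinfun_apply A (a *\<^sub>C x + b *\<^sub>C y) = 0"
      using op_abs_powr_kernel[OF A rs] by blast
  qed
qed

section \<open>Quadratic forms and scaled isometries\<close>

text \<open>Testing with \<open>rank_one q q\<close>, where \<open>q\<close> is the part of
  \<open>y\<close> orthogonal to \<open>f\<close>, makes the right-hand side vanish and forces
  \<open>q = 0\<close>.\<close>

lemma proportional_forms_imp_parallel:
  fixes f y :: "'h::complex_hilbert_space"
  assumes forms: "\<And>C. C \<in> bounded_ops \<Longrightarrow>
      cinner (blinfun_apply C y) y = k * cinner (blinfun_apply C f) f"
    and "f \<noteq> 0"
  shows "\<exists>c. y = c *\<^sub>C f"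
proof -
  define c where "c = cinner y f / cinner f f"
  define q where "q = y - c *\<^sub>C f"
  have fq: "cinner f q = 0" using \<open>f \<noteq> 0\<close>
    by (simp add: q_def c_def cinner_simps cinner_self) (simp add: cinner_commute[of f y])
  have "cinner y q * cinner q y = 0" using forms[of "rank_one q q"] fq by (simp add: cinner_simps)
  then have "cinner y q = 0" by (metis cinner_commute complex_cnj_zero_iff mult_eq_0_iff)
  then have "cinner q q = 0" using fq by (subst (1) q_def) (simp add: cinner_simps)
  then show ?thesis by (auto simp: q_def)
qed

text \<open>Polarisation: \<open>op_adjoint T o\<^sub>L T\<close> minus \<open>k\<^sup>2\<close>
  times the identity has zero quadratic form.\<close>

lemma norm_scaling_imp_cinner:
  assumes T: "T \<in> bounded_ops" and norm: "\<And>x. norm (blinfun_apply T x) = k * norm x"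
  shows "cinner (blinfun_apply T x) (blinfun_apply T y) = of_real (k\<^sup>2) * cinner x y"
proof -
  let ?D = "(op_adjoint T o\<^sub>L T) - k\<^sup>2 *\<^sub>R id_blinfun"
  have adj: "cinner (blinfun_apply (op_adjoint T) (blinfun_apply T x)) y
      = cinner (blinfun_apply T x) (blinfun_apply T y)" for x y
    by (metis cinner_op_adjoint[OF T] cinner_commute)
  have D: "cinner (blinfun_apply ?D x) y =
      cinner (blinfun_apply T x) (blinfun_apply T y) - of_real (k\<^sup>2) * cinner x y" for x y
    by (simp add: blinfun.diff_left blinfun.scaleR_left cinner_simps adj)
  have "?D = 0"
  proof (rule quadratic_form_zero_imp_zero)
    show "?D \<in> bounded_ops"
      by (intro bounded_ops_diff bounded_ops_compose bounded_ops_scaleR bounded_ops_id op_adjoint_in T)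
    show "cinner (blinfun_apply ?D x) x = 0" for x
      unfolding D cinner_self norm by (simp add: power_mult_distrib)
  qed
  then show ?thesis using D[of x y] by simp
qed

section \<open>Maps preserving rank one forms\<close>

lemma bounded_ops_eqI_form:
  assumes "C \<in> bounded_ops" "D \<in> bounded_ops"
    and "\<And>w. w \<noteq> 0 \<Longrightarrow> cinner (blinfun_apply C w) w = cinner (blinfun_apply D w) w"
  shows "C = D"
proof -
  have "cinner (blinfun_apply (C - D) w) w = 0" for w
    using assms(3)[of w] by (cases "w = 0") (simp_all add: blinfun.diff_left cinner_simps)
  then have "C - D = 0"
    by (intro quadratic_form_zero_imp_zero bounded_ops_diff assms)
  then show ?thesis by simp
qed

text \<open>Absorbs the ratio of two weights into the vector, using that the form is quadratic in
  it.\<close>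

lemma rescale_form:
  assumes "k > 0" "l > 0" "of_real k * cinner (blinfun_apply B y) y = of_real l * z"
    and B: "B \<in> bounded_ops"
  shows "cinner (blinfun_apply B (of_real (sqrt (k / l)) *\<^sub>C y)) (of_real (sqrt (k / l)) *\<^sub>C y) = z"
proof -
  have "of_real (sqrt (k / l)) * of_real (sqrt (k / l)) = complex_of_real (k / l)"
    using assms(1,2) by (simp flip: of_real_mult)
  then have "cinner (blinfun_apply B (of_real (sqrt (k / l)) *\<^sub>C y)) (of_real (sqrt (k / l)) *\<^sub>C y)
      = of_real (k / l) * cinner (blinfun_apply B y) y"
    by (simp add: bounded_ops_scaleC[OF B] cinner_simps mult.assoc[symmetric] del: real_sqrt_divide)
  also have "\<dots> = z" using assms(2,3) by (simp add: field_simps)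
  finally show ?thesis .
qed

section \<open>Transport of quadratic forms and linearity\<close>

context
  fixes \<phi> :: "('h::complex_hilbert_space \<Rightarrow>\<^sub>L 'h) \<Rightarrow> ('h \<Rightarrow>\<^sub>L 'h)" and t :: real
  assumes t: "t > 0"
    and maps: "\<And>A. A \<in> bounded_ops \<Longrightarrow> \<phi> A \<in> bounded_ops"
    and surj: "\<And>C. C \<in> bounded_ops \<Longrightarrow> \<exists>A\<in>bounded_ops. \<phi> A = C"
    and rank_iff: "\<And>A. A \<in> bounded_ops \<Longrightarrow> is_rank_one (\<phi> A) \<longleftrightarrow> is_rank_one A"
    and forms: "\<And>x y x' y' B. x \<noteq> 0 \<Longrightarrow> y \<noteq> 0 \<Longrightarrow> x' \<noteq> 0 \<Longrightarrow> y' \<noteq> 0 \<Longrightarrow>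
      \<phi> (rank_one x y) = rank_one x' y' \<Longrightarrow> B \<in> bounded_ops \<Longrightarrow>
      of_real (weight t x y) * cinner (blinfun_apply B y) y =
      of_real (weight t x' y') * cinner (blinfun_apply (\<phi> B) y') y'"
begin

text \<open>A preimage of \<open>rank_one w w\<close> has rank one, say \<open>rank_one x y\<close>;
  the vector \<open>v\<close> is \<open>y\<close> rescaled by the weights.\<close>

lemma form_at_target:
  assumes "w \<noteq> 0"
  shows "\<exists>v. v \<noteq> 0 \<and> (\<forall>B\<in>bounded_ops. cinner (blinfun_apply (\<phi> B) w) w = cinner (blinfun_apply B v) v)"
proof -
  obtain A where A: "A \<in> bounded_ops" "\<phi> A = rank_one w w" using surj[OF rank_one_in] by blast
  moreover have "is_rank_one (rank_one w w)" using assms unfolding is_rank_one_def by blast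
  ultimately obtain x y where xy: "x \<noteq> 0" "y \<noteq> 0" "A = rank_one x y"
    using rank_iff unfolding is_rank_one_def by metis
  define c where "c = sqrt (weight t x y / weight t w w)"
  have pos: "weight t x y > 0" "weight t w w > 0" using xy assms by (simp_all add: weight_pos)
  have "cinner (blinfun_apply B (of_real c *\<^sub>C y)) (of_real c *\<^sub>C y) = cinner (blinfun_apply (\<phi> B) w) w"
    if "B \<in> bounded_ops" for B
    unfolding c_def by (rule rescale_form[OF pos _ that]) (rule forms, use xy A assms that in auto)
  moreover have "of_real c *\<^sub>C y \<noteq> 0" using pos xy by (simp add: c_def)
  ultimately show ?thesis by metis
qed

lemma form_at_source:
  assumes "v \<noteq> 0"
  shows "\<exists>w. w \<noteq> 0 \<and> (\<forall>B\<in>bounded_ops. cinner (blinfun_apply (\<phi> B) w) w = cinner (blinfun_apply B v) v)"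
proof -
  have "is_rank_one (rank_one v v)" using assms unfolding is_rank_one_def by blast
  then obtain x y where xy: "x \<noteq> 0" "y \<noteq> 0" "\<phi> (rank_one v v) = rank_one x y"
    using rank_iff[OF rank_one_in] unfolding is_rank_one_def by metis
  define c where "c = sqrt (weight t x y / weight t v v)"
  have pos: "weight t x y > 0" "weight t v v > 0" using xy assms by (simp_all add: weight_pos)
  have "cinner (blinfun_apply (\<phi> B) (of_real c *\<^sub>C y)) (of_real c *\<^sub>C y) = cinner (blinfun_apply B v) v"
    if "B \<in> bounded_ops" for B
    unfolding c_def
    by (rule rescale_form[OF pos _ maps[OF that]]) (rule forms[symmetric], use xy assms that in auto)
  moreover have "of_real c *\<^sub>C y \<noteq> 0" using pos xy by (simp add: c_def)
  ultimately show ?thesis by blast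
qed

text \<open>At a given \<open>w\<close>, the forms of all \<open>\<phi> B\<close> are read off at
  one vector \<open>v\<close> independent of \<open>B\<close>, and there they are additive in
  \<open>B\<close>.\<close>

lemma map_add:
  assumes A: "A \<in> bounded_ops" and B: "B \<in> bounded_ops"
  shows "\<phi> (A + B) = \<phi> A + \<phi> B"
proof (rule bounded_ops_eqI_form)
  fix w :: 'h assume "w \<noteq> 0"
  then obtain v where v: "\<And>B. B \<in> bounded_ops \<Longrightarrow>
      cinner (blinfun_apply (\<phi> B) w) w = cinner (blinfun_apply B v) v"
    using form_at_target by blast
  show "cinner (blinfun_apply (\<phi> (A + B)) w) w = cinner (blinfun_apply (\<phi> A + \<phi> B) w) w"
    by (simp add: blinfun.add_left cinner_simps v A B bounded_ops_add)
qed (intro maps bounded_ops_add A B)+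

lemma map_scaleC:
  assumes A: "A \<in> bounded_ops" and C: "C \<in> bounded_ops"
    and eq: "\<And>x. blinfun_apply C x = c *\<^sub>C blinfun_apply A x"
  shows "blinfun_apply (\<phi> C) x = c *\<^sub>C blinfun_apply (\<phi> A) x"
proof -
  obtain S :: "'h \<Rightarrow>\<^sub>L 'h" where S: "S \<in> bounded_ops" "\<And>x. blinfun_apply S x = c *\<^sub>C x"
    using scaleC_op_exists by metis
  have "\<phi> C = S o\<^sub>L \<phi> A"
  proof (rule bounded_ops_eqI_form)
    fix w :: 'h assume "w \<noteq> 0"
    then obtain v where v: "\<And>B. B \<in> bounded_ops \<Longrightarrow>
        cinner (blinfun_apply (\<phi> B) w) w = cinner (blinfun_apply B v) v"
      using form_at_target by blast
    show "cinner (blinfun_apply (\<phi> C) w) w = cinner (blinfun_apply (S o\<^sub>L \<phi> A) w) w"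
      by (simp add: S cinner_simps v A C eq)
  qed (intro maps bounded_ops_compose S A C)+
  then show ?thesis by (simp add: S)
qed

lemma map_zero: "\<phi> 0 = 0"
  using map_add[of 0 0] by simp

text \<open>Fixing a unit vector \<open>e\<close>, the operators \<open>x \<otimes> e\<close> go to \<open>T x \<otimes> f\<close>; this defines \<open>T\<close>.\<close>

lemma left_factor_map:
  assumes e: "norm e = 1"
  shows "\<exists>T f. T \<in> bounded_ops \<and> surj (blinfun_apply T) \<and> blinfun_apply T e = f \<and>
    (\<forall>x. norm (blinfun_apply T x) = norm x) \<and>
    (\<forall>x. \<phi> (rank_one x e) = rank_one (blinfun_apply T x) f)"
proof -
  have e0: "e \<noteq> 0" using e by auto
  obtain w where w: "w \<noteq> 0" "\<And>B. B \<in> bounded_ops \<Longrightarrow>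
      cinner (blinfun_apply (\<phi> B) w) w = cinner (blinfun_apply B e) e"
    using form_at_source[OF e0] by blast
  \<comment> \<open>\<open>f\<close> is \<open>w\<close> normalised; the lost length is recorded in
    \<open>\<mu>\<close>, which will turn out to be 1.\<close>
  define f where "f = of_real (1 / norm w) *\<^sub>C w"
  define \<mu> where "\<mu> = (norm w)\<^sup>2"
  have f: "norm f = 1" and \<mu>: "\<mu> > 0" using w(1) by (simp_all add: f_def \<mu>_def norm_divide)
  have f0: "f \<noteq> 0" using f by auto
  have form: "cinner (blinfun_apply B e) e = of_real \<mu> * cinner (blinfun_apply (\<phi> B) f) f"
    if "B \<in> bounded_ops" for B
    using w(1) unfolding w(2)[OF that, symmetric] f_def \<mu>_def
    by (simp add: bounded_ops_scaleC[OF maps[OF that]] cinner_simps power2_eq_square)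
  have ex: "\<exists>x'. \<phi> (rank_one x e) = rank_one x' f" for x
  proof (cases "x = 0")
    case True
    then show ?thesis by (intro exI[of _ 0]) (simp add: map_zero)
  next
    case False
    then have "is_rank_one (rank_one x e)" using e0 unfolding is_rank_one_def by blast
    then obtain x' y' where xy: "x' \<noteq> 0" "y' \<noteq> 0" "\<phi> (rank_one x e) = rank_one x' y'"
      using rank_iff[OF rank_one_in] unfolding is_rank_one_def by metis
    \<comment> \<open>The forms at \<open>y'\<close> and at \<open>f\<close> both come from the form
      at \<open>e\<close>. As every \<open>C\<close> is a value of \<open>\<phi>\<close>, they are
      proportional, so \<open>y'\<close> is parallel to \<open>f\<close>.\<close>
    have "cinner (blinfun_apply C y') y' =
        of_real (weight t x e * \<mu> / weight t x' y') * cinner (blinfun_apply C f) f"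
      if "C \<in> bounded_ops" for C
    proof -
      obtain B where B: "B \<in> bounded_ops" "\<phi> B = C" using surj \<open>C \<in> bounded_ops\<close> by blast
      have "of_real (weight t x e) * (of_real \<mu> * cinner (blinfun_apply C f) f) =
          of_real (weight t x' y') * cinner (blinfun_apply C y') y'"
        using forms[OF False e0 xy(1,2,3) B(1)] form[OF B(1)] B(2) by simp
      then show ?thesis using weight_pos[OF xy(1,2), of t] by (simp add: field_simps)
    qed
    then obtain c where "y' = c *\<^sub>C f" using proportional_forms_imp_parallel[OF _ f0] by blast
    then show ?thesis using xy(3) by (auto simp: rank_one_scaleC_right)
  qed
  then obtain T where T: "\<And>x. \<phi> (rank_one x e) = rank_one (T x) f" by metis
  have T_eqI: "T x = y" if "\<phi> (rank_one x e) = rank_one y f" for x y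
    using that T[of x] rank_one_inject_left[OF _ f0] by metis
  \<comment> \<open>Comparing weights below gives
    \<open>norm (T x) powr t = \<mu> * norm x powr t\<close>, so this is the scaling factor of
    \<open>T\<close>.\<close>
  define k where "k = \<mu> powr (1 / t)"
  have k: "k > 0" "k powr t = \<mu>" using \<mu> t by (simp_all add: k_def powr_powr)
  have T_add: "T (x + y) = T x + T y" for x y
  proof (rule T_eqI)
    have *: "rank_one (x + y) e = rank_one x e + rank_one y e" for x y e :: 'h
      by (rule blinfun_eqI) (simp add: blinfun.add_left scaleC_add_right)
    show "\<phi> (rank_one (x + y) e) = rank_one (T x + T y) f" unfolding * by (simp add: map_add T)
  qed
  have T_scale: "T (c *\<^sub>C x) = c *\<^sub>C T x" for c x
  proof (rule T_eqI, rule blinfun_eqI)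
    fix z
    show "blinfun_apply (\<phi> (rank_one (c *\<^sub>C x) e)) z = blinfun_apply (rank_one (c *\<^sub>C T x) f) z"
      using map_scaleC[of "rank_one x e" "rank_one (c *\<^sub>C x) e" c z]
      by (simp add: T scaleC_scaleC mult.commute)
  qed
  have T_norm: "norm (T x) = k * norm x" for x
  proof (cases "x = 0")
    case True
    then show ?thesis using T_scale[of 0 0] by simp
  next
    case False
    have "is_rank_one (rank_one x e)" using False e0 unfolding is_rank_one_def by blast
    then have "rank_one (T x) f \<noteq> 0"
      using rank_iff[OF rank_one_in, of x e] rank_one_inject_left[of _ _ 0]
      unfolding T is_rank_one_def
      by (metis blinfun.zero_left cinner_eq_zero_iff rank_one_apply scaleC.scale_eq_0_iff)
    then have "T x \<noteq> 0" by auto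
    \<comment> \<open>The identity is a test operator whose form at \<open>e\<close> is nonzero, so
      the form can be cancelled and the weights compared.\<close>
    then have "of_real (weight t x e) * cinner (blinfun_apply id_blinfun e) e =
        complex_of_real (weight t (T x) f) * cinner (blinfun_apply (\<phi> id_blinfun) f) f"
      using forms[OF False e0 _ f0 T bounded_ops_id] by simp
    then have "of_real (weight t x e) * (of_real \<mu> * cinner (blinfun_apply (\<phi> id_blinfun) f) f) =
        complex_of_real (weight t (T x) f) * cinner (blinfun_apply (\<phi> id_blinfun) f) f"
      unfolding form[OF bounded_ops_id] .
    moreover have "cinner (blinfun_apply (\<phi> id_blinfun) f) f \<noteq> 0"
      using form[OF bounded_ops_id] e0 \<mu> by auto
    ultimately have "complex_of_real (weight t x e * \<mu>) = complex_of_real (weight t (T x) f)"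
      by simp
    then have "norm x powr t * k powr t = norm (T x) powr t"
      unfolding of_real_eq_iff weight_def e f k(2) by simp
    then have "(k * norm x) powr t = norm (T x) powr t"
      using k by (simp add: powr_mult mult.commute)
    then have "((k * norm x) powr t) powr (1 / t) = (norm (T x) powr t) powr (1 / t)" by simp
    then show ?thesis using t k by (simp add: powr_powr)
  qed
  obtain F where F: "F \<in> bounded_ops" "blinfun_apply F = T"
    using bounded_opsE[OF T_add T_scale eq_refl[OF T_norm]] .
  have T_cinner: "cinner (T x) (T y) = of_real (k\<^sup>2) * cinner x y" for x y
    using norm_scaling_imp_cinner[OF F(1), of k x y] T_norm by (simp add: F(2))
  have T_surj: "\<exists>x. T x = y" for y
  proof (cases "y = 0")
    case True
    then show ?thesis using T_scale[of 0 0] by auto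
  next
    case False
    obtain A where A: "A \<in> bounded_ops" "\<phi> A = rank_one y f" using surj[OF rank_one_in] by blast
    have "is_rank_one (rank_one y f)" using False f0 unfolding is_rank_one_def by blast
    then obtain x z where xz: "x \<noteq> 0" "z \<noteq> 0" "A = rank_one x z"
      using A rank_iff unfolding is_rank_one_def by metis
    \<comment> \<open>The same proportionality argument on the source side: the right vector
      \<open>z\<close> of a preimage of \<open>rank_one y f\<close> is parallel to
      \<open>e\<close>.\<close>
    have "cinner (blinfun_apply B z) z =
        of_real (weight t y f / (\<mu> * weight t x z)) * cinner (blinfun_apply B e) e"
      if "B \<in> bounded_ops" for B
      using forms[OF xz(1,2) False f0 _ that] A(2) form[OF that] weight_pos[OF xz(1,2), of t] \<mu>
      by (simp add: xz(3) field_simps)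
    then obtain c where "z = c *\<^sub>C e" using proportional_forms_imp_parallel[OF _ e0] by blast
    then have "\<phi> (rank_one (cnj c *\<^sub>C x) e) = rank_one y f"
      using A(2) by (simp add: xz(3) rank_one_scaleC_right)
    then show ?thesis using T_eqI by blast
  qed
  have Te_f: "cinner x e = of_real \<mu> * cinner (T x) f" for x
    using form[of "rank_one x e"] e f by (simp add: T cinner_self)
  have Te: "T e = of_real (k\<^sup>2 * \<mu>) *\<^sub>C f"
  proof (rule cinner_ext_right)
    fix y
    obtain x where "T x = y" using T_surj by blast
    then show "cinner y (T e) = cinner y (of_real (k\<^sup>2 * \<mu>) *\<^sub>C f)"
      using T_cinner[of x e] Te_f[of x] by (simp add: cinner_simps)
  qed
  \<comment> \<open>Taking norms in \<open>Te\<close> gives a second relation between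
    \<open>k\<close> and \<open>\<mu>\<close>. With \<open>k powr t = \<mu>\<close> it reads
    \<open>k powr (1 + t) = 1\<close>, which forces \<open>k = 1\<close>.\<close>
  have "k = k\<^sup>2 * \<mu>"
    using arg_cong[OF Te, of norm] T_norm[of e] e f k \<mu>
    by (simp add: norm_mult norm_power)
  then have "1 = k * k powr t" using k by (simp add: power2_eq_square)
  then have "1 = k powr (1 + t)" using k by (simp add: powr_add)
  then have "k = 1"
    using k t powr_eq_one_iff_gen[of k "1 + t"] by auto
  with k have "\<mu> = 1" by simp
  with Te \<open>k = 1\<close> have "T e = f" by simp
  then show ?thesis
    using F T_surj T_norm T \<open>k = 1\<close> by (intro exI[of _ F] exI[of _ f]) (auto simp: surj_def, metis)
qed

section \<open>Unitary implementation\<close>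

lemma implemented_by_unitary:
  assumes e: "norm (e :: 'h) = 1"
  shows "\<exists>T\<in>bounded_ops. bij (blinfun_apply T) \<and> blinfun_apply (op_adjoint T) = inv (blinfun_apply T) \<and>
    (\<forall>A\<in>bounded_ops. \<phi> A = T o\<^sub>L A o\<^sub>L op_adjoint T)"
proof -
  obtain T f where T: "T \<in> bounded_ops" and surj_T: "surj (blinfun_apply T)"
    and Te: "blinfun_apply T e = f" and norm_T: "\<And>x. norm (blinfun_apply T x) = norm x"
    and rank: "\<And>x. \<phi> (rank_one x e) = rank_one (blinfun_apply T x) f"
    using left_factor_map[OF e] by blast
  have e0: "e \<noteq> 0" using e by auto
  have T_cinner: "cinner (blinfun_apply T x) (blinfun_apply T y) = cinner x y" for x y
    using norm_scaling_imp_cinner[OF T, of 1 x y] norm_T by simp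
  have inj_T: "inj (blinfun_apply T)"
  proof (rule injI)
    fix x y assume "blinfun_apply T x = blinfun_apply T y"
    then show "x = y" using norm_T[of "x - y"] by (simp add: blinfun.diff_right)
  qed
  have generic: "cinner (blinfun_apply (\<phi> B) (blinfun_apply T v)) (blinfun_apply T v) = cinner (blinfun_apply B v) v"
    if B: "B \<in> bounded_ops" and ve: "cinner v e \<noteq> 0" for B v
  proof -
    have "v \<noteq> 0" using ve by auto
    then obtain w where w: "w \<noteq> 0" "\<And>B. B \<in> bounded_ops \<Longrightarrow>
        cinner (blinfun_apply (\<phi> B) w) w = cinner (blinfun_apply B v) v"
      using form_at_source by blast
    obtain u where u: "w = blinfun_apply T u" using surj_T by (metis surjD)
    \<comment> \<open>Testing with \<open>rank_one x e\<close> for all \<open>x\<close> gives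
      \<langle>u, e\<rangle> \<langle>x, u\<rangle> = \<langle>v, e\<rangle> \<langle>x, v\<rangle>,
      which determines \<open>u\<close> up to a scalar.\<close>
    have eq: "cnj (cinner u e) *\<^sub>C u = cnj (cinner v e) *\<^sub>C v"
    proof (rule cinner_ext_right)
      show "cinner x (cnj (cinner u e) *\<^sub>C u) = cinner x (cnj (cinner v e) *\<^sub>C v)" for x
        using w(2)[OF rank_one_in, of x e]
        by (simp add: rank u Te[symmetric] T_cinner cinner_simps)
    qed
    have "cinner u e \<noteq> 0" using eq ve \<open>v \<noteq> 0\<close> by auto
    define c where "c = cnj (cinner v e) / cnj (cinner u e)"
    have uc: "u = c *\<^sub>C v"
    proof -
      have "(1 / cnj (cinner u e)) *\<^sub>C (cnj (cinner u e) *\<^sub>C u) =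
          (1 / cnj (cinner u e)) *\<^sub>C (cnj (cinner v e) *\<^sub>C v)" using eq by simp
      with \<open>cinner u e \<noteq> 0\<close> show ?thesis by (simp add: scaleC_scaleC c_def)
    qed
    \<comment> \<open>Together with the definition of \<open>c\<close> this says that
      \<open>cnj c\<close> is the inverse of \<open>c\<close>, so \<open>c\<close> is a phase and
      drops out of quadratic forms.\<close>
    have "cinner u e = c * cinner v e" by (simp add: uc cinner_simps)
    then have "cnj c * c = 1"
      using \<open>cinner u e \<noteq> 0\<close> ve c_def by (metis (no_types, lifting) complex_cnj_divide complex_cnj_cnj
          complex_cnj_mult divide_self_if mult.commute nonzero_mult_div_cancel_right times_divide_eq_right
          complex_cnj_zero_iff)
    then show ?thesis
      using w(2)[OF B] unfolding u uc
      by (simp add: bounded_ops_scaleC[OF T] bounded_ops_scaleC[OF maps[OF B]] cinner_simps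
          mult.assoc[symmetric])
  qed
  have form: "cinner (blinfun_apply (\<phi> B) (blinfun_apply T v)) (blinfun_apply T v) = cinner (blinfun_apply B v) v"
    if B: "B \<in> bounded_ops" for B v
  proof (cases "cinner v e = 0")
    case True
    txt \<open>Both \<open>v + e\<close> and \<open>v - e\<close> are covered by the generic case; use the parallelogram identity.\<close>
    have "cinner e e \<noteq> 0" using e0 by simp
    then have "cinner (v + e) e \<noteq> 0" "cinner (v - e) e \<noteq> 0"
      using True by (simp_all add: cinner_simps)
    from generic[OF B this(1)] generic[OF B this(2)] generic[OF B \<open>cinner e e \<noteq> 0\<close>]
    show ?thesis by (simp add: blinfun.add_right blinfun.diff_right cinner_simps) algebra
  qed (rule generic[OF B])
  have inv_T: "blinfun_apply T (inv (blinfun_apply T) x) = x" for x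
    using surj_T by (simp add: surj_f_inv_f)
  obtain J where J: "J \<in> bounded_ops" "blinfun_apply J = inv (blinfun_apply T)"
  proof (rule bounded_opsE[of "inv (blinfun_apply T)" 1])
    show "inv (blinfun_apply T) (x + y) = inv (blinfun_apply T) x + inv (blinfun_apply T) y" for x y
      by (rule injD[OF inj_T]) (simp add: inv_T blinfun.add_right)
    show "inv (blinfun_apply T) (c *\<^sub>C x) = c *\<^sub>C inv (blinfun_apply T) x" for c x
      by (rule injD[OF inj_T]) (simp add: inv_T bounded_ops_scaleC[OF T])
    show "norm (inv (blinfun_apply T) x) \<le> 1 * norm x" for x
      using norm_T[of "inv (blinfun_apply T) x"] by (simp add: inv_T)
  qed
  have adj: "op_adjoint T = J"
  proof (rule op_adjoint_eqI)
    show "cinner (blinfun_apply T x) y = cinner x (blinfun_apply J y)" for x y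
      using T_cinner[of x "blinfun_apply J y"] by (simp add: J inv_T)
  qed
  \<comment> \<open>The identity \<open>form\<close> at \<open>v = J w\<close>, with \<langle>A v,
    v\<rangle> moved to the target by the isometry \<open>T\<close>, compares the forms at
    \<open>w\<close>.\<close>
  have "\<phi> A = T o\<^sub>L A o\<^sub>L J" if A: "A \<in> bounded_ops" for A
  proof (rule bounded_ops_eqI_form)
    fix w :: 'h
    have w: "blinfun_apply T (blinfun_apply J w) = w" by (simp add: J inv_T)
    show "cinner (blinfun_apply (\<phi> A) w) w = cinner (blinfun_apply (T o\<^sub>L A o\<^sub>L J) w) w"
      using form[OF A, of "blinfun_apply J w"]
        T_cinner[of "blinfun_apply A (blinfun_apply J w)" "blinfun_apply J w"]
      by (simp add: w)
  qed (intro maps bounded_ops_compose T A J)+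
  then show ?thesis
    using T inj_T surj_T adj J(2) by (auto simp: bij_def)
qed

end

section \<open>Infinite dimension and the spectral hypothesis\<close>

text \<open>A single vector does not span; any \<open>y\<close> outside its span minus its
  projection onto \<open>v\<close> is the required vector.\<close>

lemma orthogonal_vector_exists:
  assumes "\<nexists>S :: 'h::complex_hilbert_space set. finite S \<and> scaleC.span S = UNIV"
  shows "\<exists>z :: 'h. z \<noteq> 0 \<and> cinner z v = 0"
proof (cases "v = 0")
  case True
  have "scaleC.span {} \<noteq> (UNIV :: 'h set)" using assms by blast
  then obtain z :: 'h where "z \<noteq> 0" by (auto simp: scaleC.span_empty)
  with True show ?thesis by auto
next
  case False
  have "scaleC.span {v} \<noteq> UNIV" using assms by blast
  then obtain y where y: "y \<notin> scaleC.span {v}" by blast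
  define z where "z = y - (cinner y v / cinner v v) *\<^sub>C v"
  have "cinner z v = 0" using False by (simp add: z_def cinner_simps)
  moreover have "z \<noteq> 0"
  proof
    assume "z = 0"
    then have "y = (cinner y v / cinner v v) *\<^sub>C v" by (simp add: z_def)
    then have "y \<in> scaleC.span {v}" by (metis scaleC.span_base scaleC.span_scale singletonI)
    with y show False by contradiction
  qed
  ultimately show ?thesis by blast
qed

theorem theorem1p4:
  fixes \<phi> :: "('h::complex_hilbert_space \<Rightarrow>\<^sub>L 'h) \<Rightarrow> ('h \<Rightarrow>\<^sub>L 'h)"
    and r s :: rat
  assumes infinite_dim: "\<nexists>S :: 'h set. finite S \<and> module.span scaleC S = UNIV"
    and "r > 0" and "s > 0" and "r + s > 1"
    and maps: "\<phi> \<in> bounded_ops \<rightarrow> bounded_ops"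
    and surj: "\<phi> ` bounded_ops = bounded_ops"
    and spectrum_eq: "\<And>A B. A \<in> bounded_ops \<Longrightarrow> B \<in> bounded_ops \<Longrightarrow>
       op_spectrum (op_abs_powr A (of_rat r) o\<^sub>L B o\<^sub>L op_abs_powr A (of_rat s)) =
       op_spectrum (op_abs_powr (\<phi> A) (of_rat r) o\<^sub>L \<phi> B o\<^sub>L op_abs_powr (\<phi> A) (of_rat s))"
  shows "\<exists>T :: 'h \<Rightarrow>\<^sub>L 'h. bij (blinfun_apply T) \<and>
     ((T \<in> bounded_ops \<and> blinfun_apply (op_adjoint T) = inv (blinfun_apply T) \<and>
         (\<forall>A\<in>bounded_ops. \<phi> A = T o\<^sub>L A o\<^sub>L op_adjoint T)) \<or>
      (T \<in> bounded_conj_ops \<and> blinfun_apply (conj_op_adjoint T) = inv (blinfun_apply T) \<and>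
         (\<forall>A\<in>bounded_ops. \<phi> A = T o\<^sub>L A o\<^sub>L conj_op_adjoint T)))"
proof -
  have rs: "(of_rat r :: real) > 0" "(of_rat s :: real) > 0" using assms(2,3) by simp_all
  let ?t = "of_rat r + of_rat s :: real"
  have in_ops: "\<phi> A \<in> bounded_ops" if "A \<in> bounded_ops" for A using maps that by blast
  have orth: "\<exists>z :: 'h. z \<noteq> 0 \<and> cinner z v = 0" for v
    using orthogonal_vector_exists[OF infinite_dim] .
  have rank_iff: "is_rank_one (\<phi> A) \<longleftrightarrow> is_rank_one A" if A: "A \<in> bounded_ops" for A
  proof -
    \<comment> \<open>By surjectivity, a quantifier over test operators on the target side may be
      restricted to values of \<open>\<phi>\<close>, so the spectral criteria for \<open>A\<close>
      and \<open>\<phi> A\<close> become identical.\<close>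
    have all: "(\<forall>B\<in>bounded_ops. P B) \<longleftrightarrow> (\<forall>B\<in>bounded_ops. P (\<phi> B))" for P
      using surj by (metis (mono_tags, lifting) ball_imageD imageE in_ops)
    have ex: "(\<exists>B\<in>bounded_ops. P B) \<longleftrightarrow> (\<exists>B\<in>bounded_ops. P (\<phi> B))" for P
      using all[of "\<lambda>B. \<not> P B"] by blast
    show ?thesis
      unfolding is_rank_one_iff_op_spectrum[OF A rs orth] is_rank_one_iff_op_spectrum[OF in_ops[OF A] rs orth]
        all[of "\<lambda>B. \<forall>c\<in>op_spectrum (op_abs_powr (\<phi> A) (of_rat r) o\<^sub>L B o\<^sub>L op_abs_powr (\<phi> A) (of_rat s)). _ c B"]
        ex[of "\<lambda>B. \<exists>c\<in>op_spectrum (op_abs_powr (\<phi> A) (of_rat r) o\<^sub>L B o\<^sub>L op_abs_powr (\<phi> A) (of_rat s)). _ c B"]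
      by (simp add: spectrum_eq[OF A])
  qed
  have forms: "of_real (weight ?t x y) * cinner (blinfun_apply B y) y =
      of_real (weight ?t x' y') * cinner (blinfun_apply (\<phi> B) y') y'"
    if nz: "x \<noteq> 0" "y \<noteq> 0" "x' \<noteq> 0" "y' \<noteq> 0"
      and eq: "\<phi> (rank_one x y) = rank_one x' y'" and B: "B \<in> bounded_ops" for x y x' y' B
  proof -
    obtain z z' where z: "z \<noteq> 0" "cinner z y = 0" "z' \<noteq> 0" "cinner z' y' = 0" using orth by metis
    \<comment> \<open>Both spectra consist of 0 and one further value, so equal spectra have equal
      further values, also when one of these is 0.\<close>
    show ?thesis
      using spectrum_eq[OF rank_one_in[of x y] B]
      unfolding eq op_spectrum_rank_one_sandwich[OF nz(1,2) rs z(1,2) B]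
        op_spectrum_rank_one_sandwich[OF nz(3,4) rs z(3,4) in_ops[OF B]]
      by (auto simp: doubleton_eq_iff)
  qed
  obtain z :: 'h where "z \<noteq> 0" using orth by blast
  then have "norm ((1 / norm z) *\<^sub>R z) = 1" by simp
  moreover have "\<exists>A\<in>bounded_ops. \<phi> A = C" if "C \<in> bounded_ops" for C
    using that surj by (metis imageE)
  moreover have "?t > 0" using rs by (rule add_pos_pos)
  ultimately have "\<exists>T\<in>bounded_ops. bij (blinfun_apply T) \<and>
      blinfun_apply (op_adjoint T) = inv (blinfun_apply T) \<and>
      (\<forall>A\<in>bounded_ops. \<phi> A = T o\<^sub>L A o\<^sub>L op_adjoint T)"
    using in_ops rank_iff forms by (intro implemented_by_unitary[of ?t \<phi> "(1 / norm z) *\<^sub>R z"]) blast+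
  then show ?thesis by blast
qed

end
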